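(* For every $N\in\mathbb{Z}$, the direct sum $L_N\oplus L_{-N}$ of the line bundles $L_N$ and $L_{-N}$ is isomorphic, as a left $\mathcal{C}(\mathrm{S}^2_{qs})$-module, to a free module of rank 2, i.e. $L_N\oplus L_{-N}\cong\mathcal{C}(\mathrm{S}^2_{qs})^2$.
   Context: Let $q\in(0,1)$, $s>0$. $S$ denotes the unilateral shift on $\ell^2(\mathbb{N}_0)$, $Se_n=e_{n+1}$; $\mathcal{T}$ is the Toeplitz algebra, the C*-algebra generated by $S$; $U$ is the unitary generator of $\mathcal{C}(\mathrm{S}^1)$; $\sigma:\mathcal{T}\to\mathcal{C}(\mathrm{S}^1)$ is the symbol map, the *-homomorphism with $\sigma(S)=U$. The C*-algebra $\mathcal{C}(\mathrm{S}^2_{qs})$ of the generic Podleś sphere is identified with the fibre product $$\mathcal{C}(\mathrm{S}^2_{qs})=\{(a_0,a_1)\in\mathcal{T}\oplus\mathcal{T} : \sigma(a_0)=\sigma(a_1)\}$$ with componentwise operations. The quantum line bundle of winding number $N$ is $$L_N:=\{(a_0,a_1)\in\mathcal{T}\oplus\mathcal{T} : U^N\sigma(a_0)=\sigma(a_1)\},$$ a left $\mathcal{C}(\mathrm{S}^2_{qs})$-module under componentwise multiplication $(b_0,b_1).(a_0,a_1)=(b_0a_0,b_1a_1)$. *)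

theory Defs
  imports "HOL-Analysis.Analysis" "HOL-Algebra.Module"
begin

section \<open>The Hilbert space of square-summable sequences\<close>

typedef ell2 = "{x :: nat \<Rightarrow> complex. summable (\<lambda>n. (cmod (x n))\<^sup>2)}"
  morphisms coord Abs_ell2
  by (rule exI[of _ "\<lambda>_. 0"]) simp

setup_lifting type_definition_ell2

lemma summable_coord: "summable (\<lambda>n. (cmod (coord x n))\<^sup>2)"
  using coord[of x] by simp

lemma ell2_eqI: "(\<And>n. coord x n = coord y n) \<Longrightarrow> x = y"
  by (metis coord_inject ext)

lemma norm_add_sq_le: "(cmod (a + b))\<^sup>2 \<le> 2 * (cmod a)\<^sup>2 + 2 * (cmod b)\<^sup>2"
proof -
  have "(cmod (a + b))\<^sup>2 \<le> (cmod a + cmod b)\<^sup>2"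
    by (intro power_mono norm_triangle_ineq) auto
  also have "\<dots> \<le> 2 * (cmod a)\<^sup>2 + 2 * (cmod b)\<^sup>2"
    using sum_squares_bound[of "cmod a" "cmod b"] by (simp add: power2_sum)
  finally show ?thesis .
qed

lemma summable_sq_add:
  assumes "summable (\<lambda>n. (cmod (f n))\<^sup>2)" "summable (\<lambda>n. (cmod (g n))\<^sup>2)"
  shows "summable (\<lambda>n. (cmod (f n + g n))\<^sup>2)"
  by (rule summable_comparison_test'[of "\<lambda>n. 2 * (cmod (f n))\<^sup>2 + 2 * (cmod (g n))\<^sup>2"])
     (auto intro!: summable_add summable_mult assms simp: norm_add_sq_le)

lemma summable_sq_scale:
  assumes "summable (\<lambda>n. (cmod (f n))\<^sup>2)"
  shows "summable (\<lambda>n. (cmod (c * f n))\<^sup>2)"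
  using summable_mult[OF assms, of "(cmod c)\<^sup>2"] by (simp add: norm_mult power_mult_distrib)

lemma summable_sq_scaleR:
  assumes "summable (\<lambda>n. (cmod (f n))\<^sup>2)"
  shows "summable (\<lambda>n. (cmod (r *\<^sub>R f n))\<^sup>2)"
  using summable_mult[OF assms, of "\<bar>r\<bar>\<^sup>2"] by (simp add: power_mult_distrib)

lemma summable_norm_mult:
  assumes "summable (\<lambda>n. (cmod (f n))\<^sup>2)" "summable (\<lambda>n. (cmod (g n))\<^sup>2)"
  shows "summable (\<lambda>n. cmod (f n) * cmod (g n))"
proof (rule summable_comparison_test'[of "\<lambda>n. (cmod (f n))\<^sup>2 + (cmod (g n))\<^sup>2"])
  show "summable (\<lambda>n. (cmod (f n))\<^sup>2 + (cmod (g n))\<^sup>2)"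
    by (intro summable_add assms)
  fix n
  have "cmod (f n) * cmod (g n) \<le> (cmod (f n))\<^sup>2 + (cmod (g n))\<^sup>2"
    using sum_squares_bound[of "cmod (f n)" "cmod (g n)"]
      mult_nonneg_nonneg[of "cmod (f n)" "cmod (g n)"] norm_ge_zero[of "f n"] norm_ge_zero[of "g n"]
    by linarith
  then show "norm (cmod (f n) * cmod (g n)) \<le> (cmod (f n))\<^sup>2 + (cmod (g n))\<^sup>2"
    by simp
qed

lemma summable_inner_coord: "summable (\<lambda>n. inner (coord x n) (coord y n))"
  by (rule summable_comparison_test'[OF summable_norm_mult[OF summable_coord[of x] summable_coord[of y]]])
     (simp add: Cauchy_Schwarz_ineq2)

instantiation ell2 :: real_vector
begin
lift_definition zero_ell2 :: ell2 is "\<lambda>n. 0" by simp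
lift_definition plus_ell2 :: "ell2 \<Rightarrow> ell2 \<Rightarrow> ell2" is "\<lambda>x y n. x n + y n"
  by (rule summable_sq_add)
lift_definition uminus_ell2 :: "ell2 \<Rightarrow> ell2" is "\<lambda>x n. - x n" by simp
lift_definition minus_ell2 :: "ell2 \<Rightarrow> ell2 \<Rightarrow> ell2" is "\<lambda>x y n. x n - y n"
  using summable_sq_add[of _ "\<lambda>n. - y n" for y] by fastforce
lift_definition scaleR_ell2 :: "real \<Rightarrow> ell2 \<Rightarrow> ell2" is "\<lambda>r x n. r *\<^sub>R x n"
  by (rule summable_sq_scaleR)
instance
  by standard (transfer; auto simp: fun_eq_iff algebra_simps scaleR_add_left scaleR_add_right)+
end

instantiation ell2 :: real_inner
begin
definition inner_ell2 :: "ell2 \<Rightarrow> ell2 \<Rightarrow> real" where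
  "inner_ell2 x y = (\<Sum>n. inner (coord x n) (coord y n))"
definition norm_ell2 :: "ell2 \<Rightarrow> real" where "norm_ell2 x = sqrt (inner x x)"
definition sgn_ell2 :: "ell2 \<Rightarrow> ell2" where "sgn_ell2 x = x /\<^sub>R norm x"
definition dist_ell2 :: "ell2 \<Rightarrow> ell2 \<Rightarrow> real" where "dist_ell2 x y = norm (x - y)"
definition uniformity_ell2 :: "(ell2 \<times> ell2) filter" where
  "uniformity_ell2 = (INF e\<in>{0 <..}. principal {(x, y). dist x y < e})"
definition open_ell2 :: "ell2 set \<Rightarrow> bool" where
  "open_ell2 U = (\<forall>x\<in>U. \<forall>\<^sub>F (x', y) in uniformity. x' = x \<longrightarrow> y \<in> U)"
instance
proof
  fix x y z :: ell2 and r :: real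
  show "inner x y = inner y x" by (simp add: inner_ell2_def inner_commute)
  show "inner (x + y) z = inner x z + inner y z"
    unfolding inner_ell2_def
    by (simp add: plus_ell2.rep_eq inner_add_left suminf_add summable_inner_coord)
  show "inner (r *\<^sub>R x) y = r * inner x y"
    unfolding inner_ell2_def
    by (simp add: scaleR_ell2.rep_eq suminf_mult summable_inner_coord)
  show "0 \<le> inner x x"
    unfolding inner_ell2_def by (intro suminf_nonneg summable_inner_coord) simp
  show "inner x x = 0 \<longleftrightarrow> x = 0"
  proof
    assume "inner x x = 0"
    then have "\<forall>n. inner (coord x n) (coord x n) = 0"
      unfolding inner_ell2_def
      by (subst (asm) suminf_eq_zero_iff) (auto simp: summable_inner_coord)
    then show "x = 0" by (intro ell2_eqI) (simp add: zero_ell2.rep_eq)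
  next
    assume "x = 0" then show "inner x x = 0" by (simp add: inner_ell2_def zero_ell2.rep_eq)
  qed
qed (simp_all add: norm_ell2_def sgn_ell2_def dist_ell2_def uniformity_ell2_def open_ell2_def)
end

lemma norm_ell2_sq: "(norm x)\<^sup>2 = (\<Sum>n. (cmod (coord x n))\<^sup>2)"
  unfolding power2_norm_eq_inner[of x] inner_ell2_def by (simp only: power2_norm_eq_inner)

lemma cmod_coord_le: "cmod (coord x n) \<le> norm x"
proof -
  have "(cmod (coord x n))\<^sup>2 \<le> (norm x)\<^sup>2"
    unfolding norm_ell2_sq
    using sum_le_suminf[OF summable_coord, of "{n}" x] by simp
  then show ?thesis by (rule power2_le_imp_le) simp
qed

lemma ell2_bounded_partial_sums:
  assumes "\<And>m. (\<Sum>n<m. (cmod (f n))\<^sup>2) \<le> B"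
  shows "summable (\<lambda>n. (cmod (f n))\<^sup>2)" "(\<Sum>n. (cmod (f n))\<^sup>2) \<le> B"
proof -
  show s: "summable (\<lambda>n. (cmod (f n))\<^sup>2)"
    by (rule summableI_nonneg_bounded[OF _ assms]) simp
  show "(\<Sum>n. (cmod (f n))\<^sup>2) \<le> B"
    by (rule suminf_le_const[OF s assms])
qed

lemma partial_sum_coord_le: "(\<Sum>n<m. (cmod (coord x n))\<^sup>2) \<le> (norm x)\<^sup>2"
  unfolding norm_ell2_sq by (rule sum_le_suminf[OF summable_coord]) auto

instance ell2 :: banach
proof
  fix X :: "nat \<Rightarrow> ell2"
  assume X: "Cauchy X"
  have "Cauchy (\<lambda>k. coord (X k) n)" for n
  proof (rule metric_CauchyI)
    fix e :: real assume "e > 0"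
    then obtain M where M: "\<And>i j. i \<ge> M \<Longrightarrow> j \<ge> M \<Longrightarrow> dist (X i) (X j) < e"
      using metric_CauchyD[OF X \<open>e > 0\<close>] by metis
    have "dist (coord (X i) n) (coord (X j) n) < e" if "i \<ge> M" "j \<ge> M" for i j
      using cmod_coord_le[of "X i - X j" n] M[OF that]
      by (simp add: minus_ell2.rep_eq dist_norm)
    then show "\<exists>M. \<forall>m\<ge>M. \<forall>n'\<ge>M. dist (coord (X m) n) (coord (X n') n) < e" by blast
  qed
  then have "\<exists>l. (\<lambda>k. coord (X k) n) \<longlonglongrightarrow> l" for n
    using Cauchy_convergent_iff convergent_def by blast
  then obtain l where l: "\<And>n. (\<lambda>k. coord (X k) n) \<longlonglongrightarrow> l n" by metis
  have tail: "summable (\<lambda>n. (cmod (coord (X i) n - l n))\<^sup>2) \<and> (\<Sum>n. (cmod (coord (X i) n - l n))\<^sup>2) \<le> e\<^sup>2"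
    if M: "\<And>i j. i \<ge> M \<Longrightarrow> j \<ge> M \<Longrightarrow> dist (X i) (X j) < e" and i: "i \<ge> M" for i M e
  proof -
    have "(\<Sum>n<m. (cmod (coord (X i) n - l n))\<^sup>2) \<le> e\<^sup>2" for m
    proof (rule LIMSEQ_le_const2)
      show "(\<lambda>j. \<Sum>n<m. (cmod (coord (X i) n - coord (X j) n))\<^sup>2) \<longlonglongrightarrow> (\<Sum>n<m. (cmod (coord (X i) n - l n))\<^sup>2)"
        by (intro tendsto_intros l)
      show "\<exists>N. \<forall>j\<ge>N. (\<Sum>n<m. (cmod (coord (X i) n - coord (X j) n))\<^sup>2) \<le> e\<^sup>2"
      proof (intro exI[of _ M] allI impI)
        fix j assume "j \<ge> M"
        have "(\<Sum>n<m. (cmod (coord (X i) n - coord (X j) n))\<^sup>2) \<le> (norm (X i - X j))\<^sup>2"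
          using partial_sum_coord_le[of "X i - X j" m] by (simp add: minus_ell2.rep_eq)
        also have "\<dots> \<le> e\<^sup>2"
          using M[OF i \<open>j \<ge> M\<close>] by (intro power_mono) (auto simp: dist_norm)
        finally show "(\<Sum>n<m. (cmod (coord (X i) n - coord (X j) n))\<^sup>2) \<le> e\<^sup>2" .
      qed
    qed
    from ell2_bounded_partial_sums[OF this] show ?thesis by blast
  qed
  obtain M1 where M1: "\<And>i j. i \<ge> M1 \<Longrightarrow> j \<ge> M1 \<Longrightarrow> dist (X i) (X j) < 1"
    using metric_CauchyD[OF X zero_less_one] by metis
  have "summable (\<lambda>n. (cmod (coord (X M1) n + - (coord (X M1) n - l n)))\<^sup>2)"
    using tail[OF M1 order_refl] by (intro summable_sq_add) (auto simp: summable_coord norm_minus_commute)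
  then have sl: "summable (\<lambda>n. (cmod (l n))\<^sup>2)" by simp
  define L where "L = Abs_ell2 l"
  have L: "coord L = l" using sl by (simp add: L_def Abs_ell2_inverse)
  have "X \<longlonglongrightarrow> L"
  proof (rule metric_LIMSEQ_I)
    fix e :: real assume "e > 0"
    then have e2: "e/2 > 0" by simp
    then obtain M where M: "\<And>i j. i \<ge> M \<Longrightarrow> j \<ge> M \<Longrightarrow> dist (X i) (X j) < e/2"
      using metric_CauchyD[OF X e2] by metis
    have "dist (X i) L < e" if "i \<ge> M" for i
    proof -
      have "(norm (X i - L))\<^sup>2 \<le> (e/2)\<^sup>2"
      proof -
        have "(\<Sum>n. (cmod (coord (X i) n - l n))\<^sup>2) \<le> (e/2)\<^sup>2"
          using tail[of M "e/2" i] M that by metis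
        then show ?thesis by (simp only: norm_ell2_sq minus_ell2.rep_eq L)
      qed
      then have "norm (X i - L) \<le> e/2" using \<open>e > 0\<close> by (auto intro: power2_le_imp_le[of "norm (X i - L)" "e/2"] simp del: power_divide)
      then show ?thesis using \<open>e > 0\<close> by (simp add: dist_norm)
    qed
    then show "\<exists>no. \<forall>n\<ge>no. dist (X n) L < e" by blast
  qed
  then show "convergent X" by (rule convergentI)
qed

lift_definition scaleC :: "complex \<Rightarrow> ell2 \<Rightarrow> ell2" is "\<lambda>c x n. c * x n"
  by (rule summable_sq_scale)

text \<open>The complex inner product is linear in its first argument; its real part is the
  real inner product of the type class \<^class>\<open>real_inner\<close> (lemma \<open>Re_cinner\<close> below).\<close>

definition cinner :: "ell2 \<Rightarrow> ell2 \<Rightarrow> complex" where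
  "cinner x y = (\<Sum>n. coord x n * cnj (coord y n))"

lift_definition basis_vec :: "nat \<Rightarrow> ell2" is "\<lambda>k n. if n = k then 1 else 0"
  by (rule summable_finite[of "{k}" for k]) auto

lift_definition shift_fun :: "ell2 \<Rightarrow> ell2" is "\<lambda>x n. case n of 0 \<Rightarrow> 0 | Suc m \<Rightarrow> x m"
  by (subst summable_Suc_iff[symmetric]) simp

lift_definition backshift_fun :: "ell2 \<Rightarrow> ell2" is "\<lambda>x n. x (Suc n)"
  by (subst summable_Suc_iff) simp

lemma norm_scaleC: "norm (scaleC c x) = cmod c * norm x"
proof -
  have "(norm (scaleC c x))\<^sup>2 = (cmod c * norm x)\<^sup>2"
    by (simp add: norm_ell2_sq scaleC.rep_eq norm_mult power_mult_distrib suminf_mult summable_coord)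
  then show ?thesis by (simp add: power2_eq_iff_nonneg)
qed

lemma bounded_linear_scaleC: "bounded_linear (scaleC c)"
  by (rule bounded_linear_intro[of _ "cmod c"])
     (auto intro!: ell2_eqI simp: scaleC.rep_eq plus_ell2.rep_eq scaleR_ell2.rep_eq algebra_simps norm_scaleC)

lemma norm_shift_fun: "norm (shift_fun x) = norm x"
proof -
  have "(norm (shift_fun x))\<^sup>2 = (norm x)\<^sup>2"
    unfolding norm_ell2_sq
    by (subst suminf_split_head[OF summable_coord[of "shift_fun x"], symmetric, simplified] suminf_split_initial_segment[OF summable_coord, of _ 1])
       (simp add: shift_fun.rep_eq)
  then show ?thesis by (simp add: power2_eq_iff_nonneg)
qed

lemma norm_backshift_fun: "norm (backshift_fun x) \<le> norm x"
proof -
  have "(norm (backshift_fun x))\<^sup>2 \<le> (norm x)\<^sup>2"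
    unfolding norm_ell2_sq
    by (subst (2) suminf_split_initial_segment[OF summable_coord, of _ 1]) (simp add: backshift_fun.rep_eq)
  then show ?thesis by (rule power2_le_imp_le) simp
qed

lemma bounded_linear_shift_fun: "bounded_linear shift_fun"
  by (rule bounded_linear_intro[of _ 1])
     (auto intro!: ell2_eqI simp: shift_fun.rep_eq plus_ell2.rep_eq scaleR_ell2.rep_eq norm_shift_fun split: nat.split)

lemma bounded_linear_backshift_fun: "bounded_linear backshift_fun"
  by (rule bounded_linear_intro[of _ 1])
     (auto intro!: ell2_eqI simp: backshift_fun.rep_eq plus_ell2.rep_eq scaleR_ell2.rep_eq norm_backshift_fun)

lemma summable_cinner: "summable (\<lambda>n. coord x n * cnj (coord y n))"
proof (rule summable_norm_cancel)
  show "summable (\<lambda>n. norm (coord x n * cnj (coord y n)))"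
    using summable_norm_mult[OF summable_coord[of x] summable_coord[of y]] by (simp add: norm_mult)
qed

lemma cinner_add_left: "cinner (x + y) z = cinner x z + cinner y z"
  unfolding cinner_def by (simp add: plus_ell2.rep_eq distrib_right suminf_add summable_cinner)

lemma cinner_scaleC_left: "cinner (scaleC c x) z = c * cinner x z"
  unfolding cinner_def by (simp add: scaleC.rep_eq mult.assoc suminf_mult summable_cinner)

lemma cinner_commute: "cinner y x = cnj (cinner x y)"
proof -
  have "(\<lambda>n. cnj (coord x n * cnj (coord y n))) sums cnj (cinner x y)"
    unfolding cinner_def sums_cnj by (rule summable_sums[OF summable_cinner])
  then show ?thesis
    unfolding cinner_def[of y x] by (simp add: sums_iff mult.commute)
qed

lemma cinner_add_right: "cinner z (x + y) = cinner z x + cinner z y"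
  by (metis cinner_add_left cinner_commute complex_cnj_add)

lemma cinner_scaleC_right: "cinner z (scaleC c x) = cnj c * cinner z x"
  by (metis cinner_scaleC_left cinner_commute complex_cnj_mult)

lemma inner_complex_Re: "inner a b = Re (a * cnj b)"
  by (simp add: inner_complex_def)

lemma Re_cinner: "Re (cinner x y) = inner x y"
proof -
  have "(\<lambda>n. Re (coord x n * cnj (coord y n))) sums Re (cinner x y)"
    unfolding cinner_def by (rule sums_Re[OF summable_sums[OF summable_cinner]])
  then show ?thesis
    unfolding inner_ell2_def inner_complex_Re by (simp only: sums_iff)
qed

lemma cinner_self: "cinner x x = of_real ((norm x)\<^sup>2)"
proof (rule complex_eqI)
  show "Re (cinner x x) = Re (of_real ((norm x)\<^sup>2))"
    by (simp add: Re_cinner power2_norm_eq_inner)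
  show "Im (cinner x x) = Im (of_real ((norm x)\<^sup>2))"
    using arg_cong[OF cinner_commute[of x x], of Im] by simp
qed

lemma cmod_cinner_le: "cmod (cinner x y) \<le> norm x * norm y"
proof (cases "cinner x y = 0")
  case False
  define c where "c = cinner x y"
  have "(cmod c)\<^sup>2 = Re (cinner (scaleC (cnj c) x) y)"
    by (simp add: cinner_scaleC_left c_def[symmetric] mult.commute[of "cnj c"] flip: complex_norm_square)
  also have "\<dots> \<le> norm (scaleC (cnj c) x) * norm y"
    unfolding Re_cinner by (rule norm_cauchy_schwarz)
  also have "\<dots> = cmod c * (norm x * norm y)" by (simp add: norm_scaleC)
  finally show ?thesis using False by (simp add: power2_eq_square c_def)
qed simp

lemma cinner_diff_left: "cinner (x - y) z = cinner x z - cinner y z"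
  using cinner_add_left[of "x - y" y z] by simp

lemma cinner_diff_right: "cinner z (x - y) = cinner z x - cinner z y"
  using cinner_add_right[of z "x - y" y] by simp

section \<open>The Toeplitz algebra\<close>

text \<open>The type \<^typ>\<open>ell2 \<Rightarrow>\<^sub>L ell2\<close> consists of the bounded real-linear operators, with the
  operator norm. An operator that has an adjoint for \<^const>\<open>cinner\<close> is complex-linear
  (\<open>is_adjoint_scaleC\<close>), and every element of \<open>toeplitz\<close> has one (\<open>toeplitz_adjoint\<close>), so
  that only complex-linear operators occur in the Toeplitz algebra.\<close>

type_synonym operator = "ell2 \<Rightarrow>\<^sub>L ell2"

definition scale_op :: "complex \<Rightarrow> operator \<Rightarrow> operator" where
  "scale_op c A = Blinfun (\<lambda>x. scaleC c (A x))"

definition shift :: operator where "shift = Blinfun shift_fun"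
definition backshift :: operator where "backshift = Blinfun backshift_fun"

definition is_adjoint :: "operator \<Rightarrow> operator \<Rightarrow> bool" where
  "is_adjoint A B \<longleftrightarrow> (\<forall>x y. cinner (A x) y = cinner x (B y))"

inductive_set star_algebra :: "operator set \<Rightarrow> operator set" for X where
  gen: "A \<in> X \<Longrightarrow> A \<in> star_algebra X"
| adj: "A \<in> star_algebra X \<Longrightarrow> is_adjoint A B \<Longrightarrow> B \<in> star_algebra X"
| add: "A \<in> star_algebra X \<Longrightarrow> B \<in> star_algebra X \<Longrightarrow> A + B \<in> star_algebra X"
| scale: "A \<in> star_algebra X \<Longrightarrow> scale_op c A \<in> star_algebra X"
| comp: "A \<in> star_algebra X \<Longrightarrow> B \<in> star_algebra X \<Longrightarrow> A o\<^sub>L B \<in> star_algebra X"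

text \<open>\<open>star_algebra X\<close> is the (complex, not necessarily unital) *-algebra generated by \<open>X\<close>;
  its norm closure is the C*-algebra generated by \<open>X\<close>. The Toeplitz algebra contains the
  identity because the shift is an isometry (\<open>id_in_toeplitz\<close>).\<close>

definition cstar_algebra :: "operator set \<Rightarrow> operator set" where
  "cstar_algebra X = closure (star_algebra X)"

definition toeplitz :: "operator set" where
  "toeplitz = cstar_algebra {shift}"

lemma shift_apply [simp]: "blinfun_apply shift x = shift_fun x"
  by (simp add: shift_def bounded_linear_Blinfun_apply bounded_linear_shift_fun)

lemma backshift_apply [simp]: "blinfun_apply backshift x = backshift_fun x"
  by (simp add: backshift_def bounded_linear_Blinfun_apply bounded_linear_backshift_fun)

lemma shift_basis_vec: "shift (basis_vec n) = basis_vec (Suc n)"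
  by (rule ell2_eqI) (auto simp: shift_fun.rep_eq basis_vec.rep_eq split: nat.split)

lemma scale_op_apply [simp]: "blinfun_apply (scale_op c A) x = scaleC c (A x)"
  unfolding scale_op_def
  by (simp add: bounded_linear_Blinfun_apply
      bounded_linear_compose[OF bounded_linear_scaleC blinfun.bounded_linear_right])

lemma is_adjoint_sym: "is_adjoint A B \<Longrightarrow> is_adjoint B A"
  unfolding is_adjoint_def by (metis cinner_commute)

lemma is_adjoint_unique:
  assumes "is_adjoint A B" "is_adjoint A B'" shows "B = B'"
proof (rule blinfun_eqI)
  fix y
  have "cinner x (B y) = cinner x (B' y)" for x
    using assms[unfolded is_adjoint_def, rule_format, of x y] by simp
  then have "cinner (B y - B' y) (B y - B' y) = 0"
    by (simp add: cinner_diff_right[of _ "B y" "B' y"])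
  then show "B y = B' y" by (simp add: cinner_self)
qed

lemma is_adjoint_shift: "is_adjoint shift backshift"
  unfolding is_adjoint_def
proof (intro allI)
  fix x y
  show "cinner (shift x) y = cinner x (backshift y)"
    unfolding cinner_def
    by (subst suminf_split_initial_segment[OF summable_cinner, of _ _ 1])
       (simp add: shift_fun.rep_eq backshift_fun.rep_eq)
qed

lemma is_adjoint_add: "is_adjoint A A' \<Longrightarrow> is_adjoint B B' \<Longrightarrow> is_adjoint (A + B) (A' + B')"
  by (simp add: is_adjoint_def blinfun.add_left cinner_add_left cinner_add_right)

lemma is_adjoint_scale: "is_adjoint A A' \<Longrightarrow> is_adjoint (scale_op c A) (scale_op (cnj c) A')"
  by (simp add: is_adjoint_def cinner_scaleC_left cinner_scaleC_right)

lemma is_adjoint_comp: "is_adjoint A A' \<Longrightarrow> is_adjoint B B' \<Longrightarrow> is_adjoint (A o\<^sub>L B) (B' o\<^sub>L A')"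
  by (simp add: is_adjoint_def)

lemma is_adjoint_diff: "is_adjoint A A' \<Longrightarrow> is_adjoint B B' \<Longrightarrow> is_adjoint (A - B) (A' - B')"
  by (simp add: is_adjoint_def blinfun.diff_left cinner_diff_left cinner_diff_right)

lemma norm_adjoint_le:
  assumes "is_adjoint A B" shows "norm B \<le> norm A"
proof (rule norm_blinfun_bound)
  fix y
  have "(norm (B y))\<^sup>2 = cmod (cinner (A (B y)) y)"
    using assms unfolding is_adjoint_def by (simp add: cinner_self norm_power)
  also have "\<dots> \<le> norm (A (B y)) * norm y" by (rule cmod_cinner_le)
  also have "\<dots> \<le> (norm A * norm (B y)) * norm y"
    by (intro mult_right_mono norm_blinfun) simp
  finally have "norm (B y) * norm (B y) \<le> norm (B y) * (norm A * norm y)"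
    by (simp add: power2_eq_square mult_ac)
  then show "norm (B y) \<le> norm A * norm y"
    by (cases "norm (B y) = 0") (auto simp: mult_le_cancel_left)
qed simp

lemma norm_scale_op: "norm (scale_op c A) = cmod c * norm A"
proof -
  have le: "norm (scale_op c A) \<le> cmod c * norm A" for c A
  proof (rule norm_blinfun_bound)
    fix x show "norm (scale_op c A x) \<le> cmod c * norm A * norm x"
      using mult_left_mono[OF norm_blinfun[of A x], of "cmod c"] by (simp add: norm_scaleC mult_ac)
  qed simp
  show ?thesis
  proof (cases "c = 0")
    case True
    then show ?thesis using le[of 0 A] by simp
  next
    case False
    have "scale_op (1/c) (scale_op c A) = A"
      using False by (intro blinfun_eqI ell2_eqI) (simp add: scaleC.rep_eq)
    then have "norm A \<le> cmod (1/c) * norm (scale_op c A)"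
      using le[of "1/c" "scale_op c A"] by simp
    then have "cmod c * norm A \<le> norm (scale_op c A)"
      using False by (simp add: norm_divide field_simps)
    then show ?thesis using le[of c A] by simp
  qed
qed

lemma scaleC_minus_right: "scaleC c (x - y) = scaleC c x - scaleC c y"
  by (rule ell2_eqI) (simp add: scaleC.rep_eq minus_ell2.rep_eq algebra_simps)
lemma scaleC_add_right: "scaleC c (x + y) = scaleC c x + scaleC c y"
  by (rule ell2_eqI) (simp add: scaleC.rep_eq plus_ell2.rep_eq algebra_simps)
lemma scaleC_add_left: "scaleC (c + d) x = scaleC c x + scaleC d x"
  by (rule ell2_eqI) (simp add: scaleC.rep_eq plus_ell2.rep_eq algebra_simps)
lemma scaleC_diff_left: "scaleC (c - d) x = scaleC c x - scaleC d x"
  by (rule ell2_eqI) (simp add: scaleC.rep_eq minus_ell2.rep_eq algebra_simps)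
lemma scaleC_scaleC [simp]: "scaleC c (scaleC d x) = scaleC (c * d) x"
  by (rule ell2_eqI) (simp add: scaleC.rep_eq)
lemma scaleC_one [simp]: "scaleC 1 x = x"
  by (rule ell2_eqI) (simp add: scaleC.rep_eq)

lemma scale_op_diff: "scale_op c (A - B) = scale_op c A - scale_op c B"
  by (rule blinfun_eqI) (simp add: blinfun.diff_left scaleC_minus_right)

lemma shift_in_toeplitz: "shift \<in> toeplitz"
  unfolding toeplitz_def cstar_algebra_def
  by (rule subsetD[OF closure_subset]) (simp add: star_algebra.gen)

lemma toeplitz_add:
  assumes "A \<in> toeplitz" "B \<in> toeplitz" shows "A + B \<in> toeplitz"
proof -
  obtain a b where "\<And>n. a n \<in> star_algebra {shift}" "a \<longlonglongrightarrow> A" "\<And>n. b n \<in> star_algebra {shift}" "b \<longlonglongrightarrow> B"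
    using assms unfolding toeplitz_def cstar_algebra_def closure_sequential by blast
  then show ?thesis unfolding toeplitz_def cstar_algebra_def closure_sequential
    by (intro exI[of _ "\<lambda>n. a n + b n"]) (auto intro: star_algebra.add tendsto_add)
qed

lemma toeplitz_comp:
  assumes "A \<in> toeplitz" "B \<in> toeplitz" shows "A o\<^sub>L B \<in> toeplitz"
proof -
  obtain a b where "\<And>n. a n \<in> star_algebra {shift}" "a \<longlonglongrightarrow> A" "\<And>n. b n \<in> star_algebra {shift}" "b \<longlonglongrightarrow> B"
    using assms unfolding toeplitz_def cstar_algebra_def closure_sequential by blast
  then show ?thesis unfolding toeplitz_def cstar_algebra_def closure_sequential
    by (intro exI[of _ "\<lambda>n. a n o\<^sub>L b n"])
       (auto intro: star_algebra.comp bounded_bilinear.tendsto[OF bounded_bilinear_blinfun_compose])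
qed

lemma toeplitz_scale:
  assumes "A \<in> toeplitz" shows "scale_op c A \<in> toeplitz"
proof -
  obtain a where a: "\<And>n. a n \<in> star_algebra {shift}" "a \<longlonglongrightarrow> A"
    using assms unfolding toeplitz_def cstar_algebra_def closure_sequential by blast
  have "(\<lambda>n. cmod c * norm (a n - A)) \<longlonglongrightarrow> cmod c * 0"
    using a(2) by (intro tendsto_intros) (simp add: LIM_zero tendsto_norm_zero)
  then have "(\<lambda>n. scale_op c (a n)) \<longlonglongrightarrow> scale_op c A"
    by (rule_tac LIM_zero_cancel, rule_tac tendsto_norm_zero_cancel)
       (simp add: norm_scale_op flip: scale_op_diff)
  with a show ?thesis unfolding toeplitz_def cstar_algebra_def closure_sequential
    by (intro exI[of _ "\<lambda>n. scale_op c (a n)"]) (auto intro: star_algebra.scale)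
qed

lemma star_algebra_has_adjoint:
  assumes "A \<in> star_algebra {shift}" shows "\<exists>B. is_adjoint A B"
  using assms
proof induction
  case (gen A) then show ?case using is_adjoint_shift by auto
next
  case (adj A B) then show ?case using is_adjoint_sym by blast
next
  case (add A B) then show ?case using is_adjoint_add by blast
next
  case (scale A c) then show ?case using is_adjoint_scale by blast
next
  case (comp A B) then show ?case using is_adjoint_comp by blast
qed

lemma toeplitz_adjoint:
  assumes "A \<in> toeplitz"
  shows "\<exists>B\<in>toeplitz. is_adjoint A B"
proof -
  obtain a where a: "\<And>n. a n \<in> star_algebra {shift}" "a \<longlonglongrightarrow> A"
    using assms unfolding toeplitz_def cstar_algebra_def closure_sequential by blast
  obtain b where b: "\<And>n. is_adjoint (a n) (b n)"
    using star_algebra_has_adjoint[OF a(1)] by metis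
  have le: "dist (b m) (b n) \<le> dist (a m) (a n)" for m n
    unfolding dist_norm by (rule norm_adjoint_le[OF is_adjoint_diff[OF b b]])
  have "Cauchy a" using a(2) by (simp add: LIMSEQ_imp_Cauchy)
  then have "Cauchy b"
    unfolding Cauchy_def by (smt (verit, best) le)
  then obtain B where B: "b \<longlonglongrightarrow> B"
    using Cauchy_convergent_iff convergent_def by blast
  have BT: "B \<in> toeplitz" unfolding toeplitz_def cstar_algebra_def closure_sequential
    using B star_algebra.adj[OF a(1) b] by blast
  have "cinner (A x) y = cinner x (B y)" for x y
  proof -
    have 1: "(\<lambda>n. cinner (a n x) y) \<longlonglongrightarrow> cinner (A x) y"
    proof (rule LIM_zero_cancel, rule Lim_null_comparison)
      show "\<forall>\<^sub>F n in sequentially. norm (cinner (a n x) y - cinner (A x) y) \<le> norm (a n x - A x) * norm y"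
        by (auto simp: cmod_cinner_le simp flip: cinner_diff_left)
      have "(\<lambda>n. a n x) \<longlonglongrightarrow> A x" by (intro blinfun.tendsto a(2) tendsto_const)
      then have "(\<lambda>n. norm (a n x - A x)) \<longlonglongrightarrow> 0" by (simp add: LIM_zero tendsto_norm_zero)
      then show "(\<lambda>n. norm (a n x - A x) * norm y) \<longlonglongrightarrow> 0" by (rule tendsto_mult_left_zero)
    qed
    have 2: "(\<lambda>n. cinner x (b n y)) \<longlonglongrightarrow> cinner x (B y)"
    proof (rule LIM_zero_cancel, rule Lim_null_comparison)
      show "\<forall>\<^sub>F n in sequentially. norm (cinner x (b n y) - cinner x (B y)) \<le> norm x * norm (b n y - B y)"
        by (auto simp: cmod_cinner_le simp flip: cinner_diff_right)
      have "(\<lambda>n. b n y) \<longlonglongrightarrow> B y" by (intro blinfun.tendsto B tendsto_const)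
      then have "(\<lambda>n. norm (b n y - B y)) \<longlonglongrightarrow> 0" by (simp add: LIM_zero tendsto_norm_zero)
      then show "(\<lambda>n. norm x * norm (b n y - B y)) \<longlonglongrightarrow> 0" by (rule tendsto_mult_right_zero)
    qed
    have "cinner (a n x) y = cinner x (b n y)" for n using b unfolding is_adjoint_def by blast
    then show ?thesis using 1 2 LIMSEQ_unique by auto
  qed
  with BT show ?thesis unfolding is_adjoint_def by blast
qed

lemma toeplitz_adj: "A \<in> toeplitz \<Longrightarrow> is_adjoint A B \<Longrightarrow> B \<in> toeplitz"
  using toeplitz_adjoint is_adjoint_unique by blast

lemma backshift_in_toeplitz: "backshift \<in> toeplitz"
  using toeplitz_adj[OF shift_in_toeplitz is_adjoint_shift] .

lemma backshift_shift: "backshift o\<^sub>L shift = id_blinfun"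
  by (intro blinfun_eqI ell2_eqI) (simp add: shift_fun.rep_eq backshift_fun.rep_eq)

lemma id_in_toeplitz: "id_blinfun \<in> toeplitz"
  using toeplitz_comp[OF backshift_in_toeplitz shift_in_toeplitz] by (simp add: backshift_shift)

lemma zero_in_toeplitz: "0 \<in> toeplitz"
proof -
  have "scale_op 0 shift = 0"
    by (intro blinfun_eqI ell2_eqI) (simp add: scaleC.rep_eq zero_ell2.rep_eq)
  then show ?thesis using toeplitz_scale[OF shift_in_toeplitz] by metis
qed

lemma uminus_in_toeplitz: assumes "A \<in> toeplitz" shows "- A \<in> toeplitz"
proof -
  have "scale_op (-1) A = - A"
    by (intro blinfun_eqI ell2_eqI) (simp add: scaleC.rep_eq uminus_ell2.rep_eq blinfun.minus_left)
  then show ?thesis using toeplitz_scale[OF assms] by metis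
qed

lemma closed_toeplitz: "closed toeplitz"
  by (simp add: toeplitz_def cstar_algebra_def)

section \<open>The symbol map\<close>

text \<open>Continuous functions on the unit circle are represented by functions on \<^typ>\<open>complex\<close>
  that are \<^const>\<open>undefined\<close> outside the circle, so that equality of functions is equality
  on the circle. The unitary generator \<open>U\<close> is the inclusion of the circle, and
  \<open>U_power N\<close> is its \<open>N\<close>-th power.\<close>

definition circle :: "complex set" where "circle = sphere 0 1"

definition C_circle :: "(complex \<Rightarrow> complex) set" where
  "C_circle = {f \<in> extensional circle. continuous_on circle f}"

definition U_power :: "int \<Rightarrow> complex \<Rightarrow> complex" where
  "U_power N = (\<lambda>z\<in>circle. z powi N)"

text \<open>A *-homomorphism from the Toeplitz algebra to the continuous functions on the circle,
  sending the shift to \<open>U\<close>; functions on the Toeplitz algebra are extended by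
  \<^const>\<open>undefined\<close>, so that there is exactly one (\<open>symbol_map_exists\<close>,
  \<open>symbol_map_unique\<close>).\<close>

definition symbol_map :: "(operator \<Rightarrow> complex \<Rightarrow> complex) \<Rightarrow> bool" where
  "symbol_map \<sigma> \<longleftrightarrow>
     \<sigma> \<in> toeplitz \<rightarrow>\<^sub>E C_circle \<and>
     (\<forall>A\<in>toeplitz. \<forall>B\<in>toeplitz. \<sigma> (A + B) = (\<lambda>z\<in>circle. \<sigma> A z + \<sigma> B z)) \<and>
     (\<forall>c. \<forall>A\<in>toeplitz. \<sigma> (scale_op c A) = (\<lambda>z\<in>circle. c * \<sigma> A z)) \<and>
     (\<forall>A\<in>toeplitz. \<forall>B\<in>toeplitz. \<sigma> (A o\<^sub>L B) = (\<lambda>z\<in>circle. \<sigma> A z * \<sigma> B z)) \<and>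
     (\<forall>A\<in>toeplitz. \<forall>B. is_adjoint A B \<longrightarrow> \<sigma> B = (\<lambda>z\<in>circle. cnj (\<sigma> A z))) \<and>
     \<sigma> shift = U_power 1"

lemma symbol_map_add: "symbol_map \<sigma> \<Longrightarrow> A \<in> toeplitz \<Longrightarrow> B \<in> toeplitz \<Longrightarrow> z \<in> circle \<Longrightarrow> \<sigma> (A + B) z = \<sigma> A z + \<sigma> B z"
  by (simp add: symbol_map_def)
lemma symbol_map_comp: "symbol_map \<sigma> \<Longrightarrow> A \<in> toeplitz \<Longrightarrow> B \<in> toeplitz \<Longrightarrow> z \<in> circle \<Longrightarrow> \<sigma> (A o\<^sub>L B) z = \<sigma> A z * \<sigma> B z"
  by (simp add: symbol_map_def)
lemma symbol_map_scale: "symbol_map \<sigma> \<Longrightarrow> A \<in> toeplitz \<Longrightarrow> z \<in> circle \<Longrightarrow> \<sigma> (scale_op c A) z = c * \<sigma> A z"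
  by (simp add: symbol_map_def)
lemma symbol_map_adj: "symbol_map \<sigma> \<Longrightarrow> A \<in> toeplitz \<Longrightarrow> is_adjoint A B \<Longrightarrow> z \<in> circle \<Longrightarrow> \<sigma> B z = cnj (\<sigma> A z)"
  by (simp add: symbol_map_def)
lemma symbol_map_shift: "symbol_map \<sigma> \<Longrightarrow> z \<in> circle \<Longrightarrow> \<sigma> shift z = z"
  by (simp add: symbol_map_def U_power_def)

lemma symbol_map_contractive:
  assumes s: "symbol_map \<sigma>" and A: "A \<in> toeplitz" and z: "z \<in> circle"
  shows "cmod (\<sigma> A z) \<le> norm A"
proof (rule ccontr)
  assume "\<not> ?thesis"
  then have big: "norm A < cmod (\<sigma> A z)" by simp
  define c where "c = \<sigma> A z"
  have c0: "c \<noteq> 0" using big norm_ge_zero[of A] unfolding c_def by auto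
  define B where "B = scale_op (1/c) A"
  have BT: "B \<in> toeplitz" unfolding B_def by (rule toeplitz_scale[OF A])
  have sB: "\<sigma> B z = 1" using symbol_map_scale[OF s A z] c0 by (simp add: B_def c_def)
  have nB: "norm B < 1" using big c0 by (simp add: B_def norm_scale_op norm_divide c_def)
  define P where "P k = ((\<lambda>X. B o\<^sub>L X) ^^ k) B" for k
  have PS: "P (Suc k) = B o\<^sub>L P k" for k by (simp add: P_def)
  have P0: "P 0 = B" by (simp add: P_def)
  have nP: "norm (P k) \<le> norm B ^ Suc k" for k
  proof (induction k)
    case (Suc k)
    have "norm (P (Suc k)) \<le> norm B * norm (P k)" unfolding PS by (rule norm_blinfun_compose)
    also have "\<dots> \<le> norm B * norm B ^ Suc k" by (intro mult_left_mono Suc) simp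
    finally show ?case by simp
  qed (simp add: P0)
  have PT: "P k \<in> toeplitz" for k
    by (induction k) (simp_all add: P0 PS BT toeplitz_comp)
  have sumP: "summable P"
  proof (rule summable_comparison_test'[of "\<lambda>k. norm B ^ Suc k"])
    show "summable (\<lambda>k. norm B ^ Suc k)"
      using nB by (subst summable_Suc_iff) (simp add: summable_geometric)
  qed (rule nP)
  define C where "C = suminf P"
  have Cs: "(\<Sum>k<Suc n. P k) \<in> toeplitz" for n
    by (induction n) (simp_all add: PT toeplitz_add)
  have "(\<lambda>n. \<Sum>k<Suc n. P k) \<longlonglongrightarrow> C"
    using summable_LIMSEQ[OF sumP] unfolding C_def by (rule LIMSEQ_Suc)
  then have CT: "C \<in> toeplitz"
    by (rule closed_sequentially[OF closed_toeplitz Cs])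
  have "C = B + (\<Sum>k. P (Suc k))"
    using suminf_split_head[OF sumP] by (simp add: C_def P0)
  also have "(\<Sum>k. P (Suc k)) = B o\<^sub>L C"
    unfolding PS C_def
    by (rule bounded_linear.suminf[OF bounded_bilinear.bounded_linear_right[OF bounded_bilinear_blinfun_compose] sumP, symmetric])
  finally have "C = B + (B o\<^sub>L C)" .
  then have "\<sigma> C z = \<sigma> (B + (B o\<^sub>L C)) z" by simp
  also have "\<dots> = \<sigma> B z + \<sigma> B z * \<sigma> C z"
    using symbol_map_add[OF s BT toeplitz_comp[OF BT CT] z] symbol_map_comp[OF s BT CT z] by simp
  also have "\<dots> = 1 + \<sigma> C z" by (simp add: sB)
  finally show False by simp
qed

lemma star_algebra_subset_toeplitz: "A \<in> star_algebra {shift} \<Longrightarrow> A \<in> toeplitz"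
  unfolding toeplitz_def cstar_algebra_def using closure_subset by blast

lemma symbol_map_diff:
  assumes s: "symbol_map \<sigma>" and "A \<in> toeplitz" "B \<in> toeplitz" "z \<in> circle"
  shows "\<sigma> (A - B) z = \<sigma> A z - \<sigma> B z"
proof -
  have "A - B \<in> toeplitz" using toeplitz_add[OF assms(2) uminus_in_toeplitz[OF assms(3)]] by simp
  from symbol_map_add[OF s this assms(3,4)] show ?thesis by simp
qed

lemma symbol_map_unique:
  assumes s: "symbol_map \<sigma>" and t: "symbol_map \<tau>"
  shows "\<sigma> = \<tau>"
proof -
  have alg: "\<sigma> A z = \<tau> A z" if "A \<in> star_algebra {shift}" "z \<in> circle" for A z
    using that(1)
  proof induction
    case (gen A) then show ?case using symbol_map_shift[OF s that(2)] symbol_map_shift[OF t that(2)] by simp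
  next
    case (adj A B)
    have "A \<in> toeplitz" using adj(1) by (rule star_algebra_subset_toeplitz)
    then show ?case using symbol_map_adj[OF s _ adj(2) that(2)] symbol_map_adj[OF t _ adj(2) that(2)] adj.IH by simp
  next
    case (add A B)
    note T = star_algebra_subset_toeplitz[OF add(1)] star_algebra_subset_toeplitz[OF add(2)]
    show ?case using symbol_map_add[OF s T that(2)] symbol_map_add[OF t T that(2)] add.IH by simp
  next
    case (scale A c)
    note T = star_algebra_subset_toeplitz[OF scale(1)]
    show ?case using symbol_map_scale[OF s T that(2)] symbol_map_scale[OF t T that(2)] scale.IH by simp
  next
    case (comp A B)
    note T = star_algebra_subset_toeplitz[OF comp(1)] star_algebra_subset_toeplitz[OF comp(2)]
    show ?case using symbol_map_comp[OF s T that(2)] symbol_map_comp[OF t T that(2)] comp.IH by simp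
  qed
  have tz: "\<sigma> A z = \<tau> A z" if A: "A \<in> toeplitz" and z: "z \<in> circle" for A z
  proof -
    obtain a where a: "\<And>n. a n \<in> star_algebra {shift}" "a \<longlonglongrightarrow> A"
      using A unfolding toeplitz_def cstar_algebra_def closure_sequential by blast
    have n0: "(\<lambda>n. norm (a n - A)) \<longlonglongrightarrow> 0" using a(2) by (simp add: LIM_zero tendsto_norm_zero)
    have lim: "(\<lambda>n. \<rho> (a n) z) \<longlonglongrightarrow> \<rho> A z" if r: "symbol_map \<rho>" for \<rho>
    proof (rule LIM_zero_cancel, rule Lim_null_comparison[OF _ n0], rule always_eventually, rule allI)
      fix n
      have T: "a n \<in> toeplitz" using a(1) by (rule star_algebra_subset_toeplitz)
      have "a n - A \<in> toeplitz" using toeplitz_add[OF T uminus_in_toeplitz[OF A]] by simp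
      from symbol_map_contractive[OF r this z]
      show "norm (\<rho> (a n) z - \<rho> A z) \<le> norm (a n - A)" by (simp add: symbol_map_diff[OF r T A z])
    qed
    have "(\<lambda>n. \<sigma> (a n) z) = (\<lambda>n. \<tau> (a n) z)" using alg[OF a(1) z] by simp
    then show ?thesis using lim[OF s] lim[OF t] LIMSEQ_unique by metis
  qed
  show ?thesis
  proof (rule PiE_ext)
    show "\<sigma> \<in> toeplitz \<rightarrow>\<^sub>E C_circle" "\<tau> \<in> toeplitz \<rightarrow>\<^sub>E C_circle" using s t by (auto simp: symbol_map_def)
    fix A assume A: "A \<in> toeplitz"
    then have "\<sigma> A \<in> C_circle" "\<tau> A \<in> C_circle" using s t by (auto simp: symbol_map_def)
    then show "\<sigma> A = \<tau> A"
      by (intro extensionalityI[of _ circle]) (auto simp: C_circle_def tz[OF A])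
  qed
qed

text \<open>For existence, the symbol of \<open>A\<close> at \<open>z\<close> is the approximate eigenvalue of \<open>A\<close> along the
  unit vectors \<open>approx_vec n z\<close>.\<close>

lift_definition approx_vec :: "nat \<Rightarrow> complex \<Rightarrow> ell2" is
  "\<lambda>n z j. if j \<le> n then cnj z ^ j / of_real (sqrt (real (Suc n))) else 0"
  by (rule summable_finite[of "{.._}"]) auto

lemma norm_basis_vec: "norm (basis_vec k) = 1"
proof -
  have "(norm (basis_vec k))\<^sup>2 = (\<Sum>n\<in>{k}. (cmod (coord (basis_vec k) n))\<^sup>2)"
    unfolding norm_ell2_sq by (rule suminf_finite) (auto simp: basis_vec.rep_eq)
  then have "(norm (basis_vec k))\<^sup>2 = 1" by (simp add: basis_vec.rep_eq)
  then show ?thesis using norm_ge_zero[of "basis_vec k"] by (simp add: power2_eq_1_iff)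
qed

lemma norm_approx_vec:
  assumes "z \<in> circle" shows "norm (approx_vec n z) = 1"
proof -
  have z: "cmod z = 1" using assms by (simp add: circle_def)
  have "(norm (approx_vec n z))\<^sup>2 = (\<Sum>j\<le>n. (cmod (coord (approx_vec n z) j))\<^sup>2)"
    unfolding norm_ell2_sq by (rule suminf_finite) (auto simp: approx_vec.rep_eq)
  also have "\<dots> = (\<Sum>j\<le>n. 1 / real (Suc n))"
    by (rule sum.cong) (auto simp: approx_vec.rep_eq norm_divide norm_power z power_divide simp del: of_nat_Suc)
  also have "\<dots> = 1" by simp
  finally show ?thesis using norm_ge_zero[of "approx_vec n z"] by (simp add: power2_eq_1_iff)
qed

definition has_symbol :: "operator \<Rightarrow> (complex \<Rightarrow> complex) \<Rightarrow> bool" where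
  "has_symbol A f \<longleftrightarrow> (\<forall>z\<in>circle. (\<lambda>n. A (approx_vec n z) - scaleC (f z) (approx_vec n z)) \<longlonglongrightarrow> 0)"

lemma inverse_sqrt_lim: "(\<lambda>n. 1 / sqrt (real (Suc n))) \<longlonglongrightarrow> 0"
proof -
  have "(\<lambda>n. sqrt (inverse (real (Suc n)))) \<longlonglongrightarrow> sqrt 0"
    by (intro tendsto_real_sqrt LIMSEQ_inverse_real_of_nat)
  then show ?thesis by (simp add: real_sqrt_divide inverse_eq_divide)
qed

lemma has_symbol_shift: "has_symbol shift (\<lambda>z. z)"
  unfolding has_symbol_def
proof
  fix z assume "z \<in> circle"
  then have z: "cmod z = 1" "z * cnj z = 1" by (simp_all add: circle_def complex_norm_square[symmetric])
  let ?s = "\<lambda>n. complex_of_real (sqrt (real (Suc n)))"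
  have eq: "shift (approx_vec n z) - scaleC z (approx_vec n z)
      = scaleC (cnj z ^ n / ?s n) (basis_vec (Suc n)) - scaleC (z / ?s n) (basis_vec 0)" for n
  proof (rule ell2_eqI)
    fix j
    show "coord (shift (approx_vec n z) - scaleC z (approx_vec n z)) j
      = coord (scaleC (cnj z ^ n / ?s n) (basis_vec (Suc n)) - scaleC (z / ?s n) (basis_vec 0)) j"
    proof (cases j)
      case 0
      then show ?thesis by (simp add: minus_ell2.rep_eq shift_fun.rep_eq scaleC.rep_eq basis_vec.rep_eq approx_vec.rep_eq)
    next
      case (Suc i)
      have "z * (cnj z ^ Suc i / ?s n) = cnj z ^ i / ?s n"
        using z(2) by (simp add: mult.assoc[symmetric])
      then show ?thesis using Suc
        by (auto simp: minus_ell2.rep_eq shift_fun.rep_eq scaleC.rep_eq basis_vec.rep_eq approx_vec.rep_eq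
            simp del: of_nat_Suc power_Suc)
    qed
  qed
  have bd: "norm (shift (approx_vec n z) - scaleC z (approx_vec n z)) \<le> 2 * (1 / sqrt (real (Suc n)))" for n
  proof -
    have "norm (scaleC (cnj z ^ n / ?s n) (basis_vec (Suc n)) - scaleC (z / ?s n) (basis_vec 0))
      \<le> norm (scaleC (cnj z ^ n / ?s n) (basis_vec (Suc n))) + norm (scaleC (z / ?s n) (basis_vec 0))"
      by (rule norm_triangle_ineq4)
    also have "\<dots> = 2 * (1 / sqrt (real (Suc n)))"
      by (simp add: norm_scaleC norm_basis_vec norm_divide norm_power z del: of_nat_Suc)
    finally show ?thesis unfolding eq .
  qed
  have "(\<lambda>n. 2 * (1 / sqrt (real (Suc n)))) \<longlonglongrightarrow> 0"
    using tendsto_mult_right_zero[OF inverse_sqrt_lim] .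
  then show "(\<lambda>n. shift (approx_vec n z) - scaleC z (approx_vec n z)) \<longlonglongrightarrow> 0"
    by (rule Lim_null_comparison[OF always_eventually[OF allI[OF bd]]])
qed

lemma has_symbol_backshift: "has_symbol backshift cnj"
  unfolding has_symbol_def
proof
  fix z assume "z \<in> circle"
  then have z: "cmod z = 1" by (simp add: circle_def)
  let ?s = "\<lambda>n. complex_of_real (sqrt (real (Suc n)))"
  have eq: "backshift (approx_vec n z) - scaleC (cnj z) (approx_vec n z)
      = scaleC (- (cnj z ^ Suc n) / ?s n) (basis_vec n)" for n
  proof (rule ell2_eqI)
    fix j
    consider "Suc j \<le> n" | "j = n" | "j > n" by linarith
    then show "coord (backshift (approx_vec n z) - scaleC (cnj z) (approx_vec n z)) j
      = coord (scaleC (- (cnj z ^ Suc n) / ?s n) (basis_vec n)) j"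
      by cases (simp_all add: minus_ell2.rep_eq backshift_fun.rep_eq scaleC.rep_eq basis_vec.rep_eq
          approx_vec.rep_eq del: of_nat_Suc)
  qed
  have bd: "norm (backshift (approx_vec n z) - scaleC (cnj z) (approx_vec n z)) \<le> 1 / sqrt (real (Suc n))" for n
    unfolding eq by (simp add: norm_scaleC norm_basis_vec norm_divide norm_power norm_mult z del: of_nat_Suc)
  show "(\<lambda>n. backshift (approx_vec n z) - scaleC (cnj z) (approx_vec n z)) \<longlonglongrightarrow> 0"
    by (rule Lim_null_comparison[OF always_eventually[OF allI[OF bd]] inverse_sqrt_lim])
qed

lemma has_symbol_add:
  assumes "has_symbol A f" "has_symbol B g" shows "has_symbol (A + B) (\<lambda>z. f z + g z)"
  unfolding has_symbol_def
proof
  fix z assume "z \<in> circle"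
  then have "(\<lambda>n. (A (approx_vec n z) - scaleC (f z) (approx_vec n z)) + (B (approx_vec n z) - scaleC (g z) (approx_vec n z))) \<longlonglongrightarrow> 0 + 0"
    using assms unfolding has_symbol_def by (intro tendsto_add) auto
  then show "(\<lambda>n. (A + B) (approx_vec n z) - scaleC (f z + g z) (approx_vec n z)) \<longlonglongrightarrow> 0"
    by (simp add: blinfun.add_left scaleC_add_left algebra_simps)
qed

lemma has_symbol_scale:
  assumes "has_symbol A f" shows "has_symbol (scale_op c A) (\<lambda>z. c * f z)"
  unfolding has_symbol_def
proof
  fix z assume "z \<in> circle"
  then have "(\<lambda>n. scaleC c (A (approx_vec n z) - scaleC (f z) (approx_vec n z))) \<longlonglongrightarrow> 0"
    using assms unfolding has_symbol_def by (intro bounded_linear.tendsto_zero[OF bounded_linear_scaleC]) auto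
  then show "(\<lambda>n. scale_op c A (approx_vec n z) - scaleC (c * f z) (approx_vec n z)) \<longlonglongrightarrow> 0"
    by (simp add: scaleC_minus_right)
qed

lemma is_adjoint_scaleC:
  assumes "is_adjoint A B" shows "A (scaleC c x) = scaleC c (A x)"
proof -
  have "cinner (A (scaleC c x)) y = cinner (scaleC c (A x)) y" for y
    using assms by (simp add: is_adjoint_def cinner_scaleC_left)
  then have "cinner (A (scaleC c x) - scaleC c (A x)) (A (scaleC c x) - scaleC c (A x)) = 0"
    by (simp add: cinner_diff_left[of "A (scaleC c x)"])
  then show ?thesis by (simp add: cinner_self)
qed

lemma has_symbol_comp:
  assumes "has_symbol A f" "has_symbol B g" "is_adjoint A A'"
  shows "has_symbol (A o\<^sub>L B) (\<lambda>z. f z * g z)"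
  unfolding has_symbol_def
proof
  fix z assume z: "z \<in> circle"
  let ?w = "\<lambda>n. approx_vec n z"
  have "(\<lambda>n. A (B (?w n) - scaleC (g z) (?w n)) + scaleC (g z) (A (?w n) - scaleC (f z) (?w n))) \<longlonglongrightarrow> 0 + 0"
    using assms(1,2) z unfolding has_symbol_def
    by (intro tendsto_add bounded_linear.tendsto_zero[OF bounded_linear_scaleC]
        bounded_linear.tendsto_zero[OF blinfun.bounded_linear_right]) auto
  then show "(\<lambda>n. (A o\<^sub>L B) (?w n) - scaleC (f z * g z) (?w n)) \<longlonglongrightarrow> 0"
    by (simp add: blinfun.diff_right scaleC_minus_right is_adjoint_scaleC[OF assms(3)] mult.commute)
qed

lemma has_symbol_dist:
  assumes "has_symbol A f" "has_symbol B g" "z \<in> circle"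
  shows "cmod (f z - g z) \<le> norm (A - B)"
proof (rule LIMSEQ_le_const)
  let ?w = "\<lambda>n. approx_vec n z"
  have "(\<lambda>n. norm (A (?w n) - scaleC (f z) (?w n))) \<longlonglongrightarrow> 0"
       "(\<lambda>n. norm (B (?w n) - scaleC (g z) (?w n))) \<longlonglongrightarrow> 0"
    using assms unfolding has_symbol_def by (auto intro: tendsto_norm_zero)
  then have "(\<lambda>n. norm (A - B) + norm (A (?w n) - scaleC (f z) (?w n)) + norm (B (?w n) - scaleC (g z) (?w n)))
     \<longlonglongrightarrow> norm (A - B) + 0 + 0" by (intro tendsto_add tendsto_const)
  then show "(\<lambda>n. norm (A - B) + norm (A (?w n) - scaleC (f z) (?w n)) + norm (B (?w n) - scaleC (g z) (?w n)))
     \<longlonglongrightarrow> norm (A - B)" by simp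
  have "cmod (f z - g z) \<le> norm (A - B) + norm (A (?w n) - scaleC (f z) (?w n)) + norm (B (?w n) - scaleC (g z) (?w n))" for n
  proof -
    have "cmod (f z - g z) = norm (scaleC (f z - g z) (?w n))"
      by (simp add: norm_scaleC norm_approx_vec[OF assms(3)])
    also have "scaleC (f z - g z) (?w n) = (A - B) (?w n) - (A (?w n) - scaleC (f z) (?w n)) + (B (?w n) - scaleC (g z) (?w n))"
      by (simp add: scaleC_diff_left blinfun.diff_left)
    also have "norm \<dots> \<le> norm ((A - B) (?w n)) + norm (A (?w n) - scaleC (f z) (?w n)) + norm (B (?w n) - scaleC (g z) (?w n))"
      by (rule order_trans[OF norm_triangle_ineq add_right_mono[OF norm_triangle_ineq4]])
    also have "norm ((A - B) (?w n)) \<le> norm (A - B)"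
      using norm_blinfun[of "A - B" "?w n"] by (simp add: norm_approx_vec[OF assms(3)])
    finally show ?thesis by simp
  qed
  then show "\<exists>N. \<forall>n\<ge>N. cmod (f z - g z) \<le> norm (A - B) + norm (A (?w n) - scaleC (f z) (?w n)) + norm (B (?w n) - scaleC (g z) (?w n))"
    by blast
qed

lemma has_symbol_unique: "has_symbol A f \<Longrightarrow> has_symbol A g \<Longrightarrow> z \<in> circle \<Longrightarrow> f z = g z"
  using has_symbol_dist[of A f A g z] by simp

lemma star_algebra_has_symbol:
  assumes "A \<in> star_algebra {shift}"
  shows "\<exists>f A'. continuous_on circle f \<and> is_adjoint A A' \<and> has_symbol A f \<and> has_symbol A' (\<lambda>z. cnj (f z))"
  using assms
proof induction
  case (gen A)
  then have "A = shift" by simp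
  then show ?case
    using is_adjoint_shift has_symbol_shift has_symbol_backshift
    by (intro exI[of _ "\<lambda>z. z"] exI[of _ backshift]) (auto intro: continuous_intros)
next
  case (adj A B)
  then obtain f A' where f: "continuous_on circle f" "is_adjoint A A'" "has_symbol A f" "has_symbol A' (\<lambda>z. cnj (f z))" by blast
  have "A' = B" using is_adjoint_unique f(2) adj(2) by blast
  with f show ?case
    by (intro exI[of _ "\<lambda>z. cnj (f z)"] exI[of _ A]) (auto intro: continuous_intros is_adjoint_sym)
next
  case (add A B)
  then obtain f A' g B' where f: "continuous_on circle f" "is_adjoint A A'" "has_symbol A f" "has_symbol A' (\<lambda>z. cnj (f z))"
   and g: "continuous_on circle g" "is_adjoint B B'" "has_symbol B g" "has_symbol B' (\<lambda>z. cnj (g z))" by blast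
  show ?case
    using is_adjoint_add[OF f(2) g(2)] has_symbol_add[OF f(3) g(3)] has_symbol_add[OF f(4) g(4)]
      continuous_on_add[OF f(1) g(1)]
    by (intro exI[of _ "\<lambda>z. f z + g z"] exI[of _ "A' + B'"]) simp
next
  case (scale A c)
  then obtain f A' where f: "continuous_on circle f" "is_adjoint A A'" "has_symbol A f" "has_symbol A' (\<lambda>z. cnj (f z))" by blast
  show ?case
    using is_adjoint_scale[OF f(2), of c] has_symbol_scale[OF f(3), of c] has_symbol_scale[OF f(4), of "cnj c"]
      continuous_on_mult[OF continuous_on_const f(1), of c]
    by (intro exI[of _ "\<lambda>z. c * f z"] exI[of _ "scale_op (cnj c) A'"]) simp
next
  case (comp A B)
  then obtain f A' g B' where f: "continuous_on circle f" "is_adjoint A A'" "has_symbol A f" "has_symbol A' (\<lambda>z. cnj (f z))"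
   and g: "continuous_on circle g" "is_adjoint B B'" "has_symbol B g" "has_symbol B' (\<lambda>z. cnj (g z))" by blast
  show ?case
    using is_adjoint_comp[OF f(2) g(2)] has_symbol_comp[OF f(3) g(3) f(2)]
      has_symbol_comp[OF g(4) f(4) is_adjoint_sym[OF g(2)]] continuous_on_mult[OF f(1) g(1)]
    by (intro exI[of _ "\<lambda>z. f z * g z"] exI[of _ "B' o\<^sub>L A'"]) (simp add: mult.commute)
qed

lemma toeplitz_has_symbol:
  assumes "A \<in> toeplitz"
  shows "\<exists>f. continuous_on circle f \<and> has_symbol A f"
proof -
  obtain a where a: "\<And>n. a n \<in> star_algebra {shift}" "a \<longlonglongrightarrow> A"
    using assms unfolding toeplitz_def cstar_algebra_def closure_sequential by blast
  have "\<forall>n. \<exists>f. continuous_on circle f \<and> has_symbol (a n) f"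
    using star_algebra_has_symbol[OF a(1)] by blast
  from choice[OF this] obtain f where "\<forall>n. continuous_on circle (f n) \<and> has_symbol (a n) (f n)"
    by (elim exE)
  then have f: "\<And>n. continuous_on circle (f n)" "\<And>n. has_symbol (a n) (f n)" by simp_all
  have "uniformly_Cauchy_on circle f"
  proof (rule uniformly_Cauchy_onI)
    fix e :: real assume "e > 0"
    then obtain M where M: "\<And>m n. m \<ge> M \<Longrightarrow> n \<ge> M \<Longrightarrow> dist (a m) (a n) < e"
      using metric_CauchyD[OF LIMSEQ_imp_Cauchy[OF a(2)]] by metis
    have "dist (f m z) (f n z) < e" if "z \<in> circle" "m \<ge> M" "n \<ge> M" for z m n
      using has_symbol_dist[OF f(2)[of m] f(2)[of n] that(1)] M[OF that(2,3)] by (simp add: dist_norm)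
    then show "\<exists>M. \<forall>z\<in>circle. \<forall>m\<ge>M. \<forall>n\<ge>M. dist (f m z) (f n z) < e" by blast
  qed
  then obtain l where l: "uniform_limit circle f l sequentially"
    using Cauchy_uniformly_convergent unfolding uniformly_convergent_on_def by blast
  have cont: "continuous_on circle l"
    by (rule uniform_limit_theorem[OF _ l]) (simp_all add: f(1))
  have "has_symbol A l" unfolding has_symbol_def
  proof
    fix z assume z: "z \<in> circle"
    let ?w = "\<lambda>n. approx_vec n z"
    have w: "norm (?w n) = 1" for n by (rule norm_approx_vec[OF z])
    show "(\<lambda>n. A (?w n) - scaleC (l z) (?w n)) \<longlonglongrightarrow> 0"
    proof (rule LIMSEQ_I)
      fix r :: real assume "r > 0"
      then have r3: "r / 3 > 0" by simp
      have "\<forall>\<^sub>F m in sequentially. dist (a m) A < r/3" using tendstoD[OF a(2) r3] .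
      moreover have "\<forall>\<^sub>F m in sequentially. dist (f m z) (l z) < r/3"
        using z by (intro eventually_mono[OF uniform_limitD[OF l r3]]) blast
      ultimately have "\<forall>\<^sub>F m in sequentially. dist (a m) A < r/3 \<and> dist (f m z) (l z) < r/3"
        by (rule eventually_conj)
      then obtain m where m: "norm (a m - A) < r/3" "cmod (f m z - l z) < r/3"
        unfolding dist_norm eventually_sequentially by blast
      obtain N where N: "\<And>n. n \<ge> N \<Longrightarrow> norm (a m (?w n) - scaleC (f m z) (?w n)) < r/3"
        using LIMSEQ_D[OF f(2)[of m, unfolded has_symbol_def, rule_format, OF z] r3] by auto
      have "norm (A (?w n) - scaleC (l z) (?w n) - 0) < r" if "n \<ge> N" for n
      proof -
        have "A (?w n) - scaleC (l z) (?w n) - 0 = (a m (?w n) - scaleC (f m z) (?w n)) - (a m - A) (?w n) + scaleC (f m z - l z) (?w n)"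
          by (simp add: blinfun.diff_left scaleC_diff_left)
        also have "norm \<dots> \<le> norm (a m (?w n) - scaleC (f m z) (?w n)) + norm ((a m - A) (?w n)) + norm (scaleC (f m z - l z) (?w n))"
          by (rule order_trans[OF norm_triangle_ineq add_right_mono[OF norm_triangle_ineq4]])
        finally show ?thesis
          using N[OF that] m norm_blinfun[of "a m - A" "?w n"] by (simp add: norm_scaleC w)
      qed
      then show "\<exists>no. \<forall>n\<ge>no. norm (A (?w n) - scaleC (l z) (?w n) - 0) < r" by blast
    qed
  qed
  with cont show ?thesis by blast
qed

lemma has_symbol_adjoint:
  assumes "has_symbol A f" "has_symbol B g" "is_adjoint A B" "z \<in> circle"
  shows "g z = cnj (f z)"
proof -
  let ?w = "\<lambda>n. approx_vec n z"
  have ww: "cinner (?w n) (?w n) = 1" for n by (simp add: cinner_self norm_approx_vec[OF assms(4)])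
  have lim: "(\<lambda>n. cinner (C (?w n)) (?w n)) \<longlonglongrightarrow> h z" if "has_symbol C h" for C h
  proof (rule LIM_zero_cancel, rule Lim_null_comparison[OF always_eventually])
    show "\<forall>n. norm (cinner (C (?w n)) (?w n) - h z) \<le> norm (C (?w n) - scaleC (h z) (?w n))"
    proof
      fix n
      have "cinner (C (?w n)) (?w n) - h z = cinner (C (?w n) - scaleC (h z) (?w n)) (?w n)"
        by (simp add: cinner_diff_left cinner_scaleC_left ww)
      then show "norm (cinner (C (?w n)) (?w n) - h z) \<le> norm (C (?w n) - scaleC (h z) (?w n))"
        using cmod_cinner_le[of "C (?w n) - scaleC (h z) (?w n)" "?w n"] norm_approx_vec[OF assms(4)] by simp
    qed
    show "(\<lambda>n. norm (C (?w n) - scaleC (h z) (?w n))) \<longlonglongrightarrow> 0"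
      using that assms(4) unfolding has_symbol_def by (auto intro: tendsto_norm_zero)
  qed
  have eq: "cinner (B (?w n)) (?w n) = cnj (cinner (A (?w n)) (?w n))" for n
    using assms(3) cinner_commute[of "B (?w n)" "?w n"] unfolding is_adjoint_def by simp
  have "(\<lambda>n. cinner (B (?w n)) (?w n)) \<longlonglongrightarrow> cnj (f z)"
    unfolding eq by (intro tendsto_cnj lim assms)
  then show ?thesis using lim[OF assms(2)] LIMSEQ_unique by blast
qed

lemma symbol_map_exists: "\<exists>\<sigma>. symbol_map \<sigma>"
proof -
  have "\<forall>A\<in>toeplitz. \<exists>f. continuous_on circle f \<and> has_symbol A f"
    using toeplitz_has_symbol by simp
  from bchoice[OF this] obtain F where "\<forall>A\<in>toeplitz. continuous_on circle (F A) \<and> has_symbol A (F A)"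
    by (elim exE)
  then have F: "\<And>A. A \<in> toeplitz \<Longrightarrow> continuous_on circle (F A)" "\<And>A. A \<in> toeplitz \<Longrightarrow> has_symbol A (F A)"
    by simp_all
  define \<sigma> where "\<sigma> = (\<lambda>A\<in>toeplitz. restrict (F A) circle)"
  have \<sigma>: "\<sigma> A = restrict (F A) circle" if "A \<in> toeplitz" for A using that by (simp add: \<sigma>_def)
  have eqI: "restrict f circle = restrict g circle" if "\<And>z. z \<in> circle \<Longrightarrow> f z = g z" for f g :: "complex \<Rightarrow> complex"
    using that by (rule restrict_ext)
  have "symbol_map \<sigma>"
    unfolding symbol_map_def
  proof (intro conjI ballI allI impI)
    show "\<sigma> \<in> toeplitz \<rightarrow>\<^sub>E C_circle"
    proof (rule PiE_I)
      fix A assume A: "A \<in> toeplitz"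
      have "continuous_on circle (restrict (F A) circle)"
        using F(1)[OF A] by (rule continuous_on_eq) simp
      then show "\<sigma> A \<in> C_circle" by (simp add: \<sigma>[OF A] C_circle_def)
    qed (simp add: \<sigma>_def)
    show "\<sigma> (A + B) = (\<lambda>z\<in>circle. \<sigma> A z + \<sigma> B z)" if "A \<in> toeplitz" "B \<in> toeplitz" for A B
      unfolding \<sigma>[OF toeplitz_add[OF that]]
      by (rule eqI) (simp add: \<sigma> that has_symbol_unique[OF F(2)[OF toeplitz_add[OF that]] has_symbol_add[OF F(2)[OF that(1)] F(2)[OF that(2)]]])
    show "\<sigma> (scale_op c A) = (\<lambda>z\<in>circle. c * \<sigma> A z)" if "A \<in> toeplitz" for A c
      unfolding \<sigma>[OF toeplitz_scale[OF that]]
      by (rule eqI) (simp add: \<sigma> that has_symbol_unique[OF F(2)[OF toeplitz_scale[OF that]] has_symbol_scale[OF F(2)[OF that]]])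
    show "\<sigma> (A o\<^sub>L B) = (\<lambda>z\<in>circle. \<sigma> A z * \<sigma> B z)" if AB: "A \<in> toeplitz" "B \<in> toeplitz" for A B
    proof -
      obtain A' where A': "is_adjoint A A'" using toeplitz_adjoint[OF AB(1)] by blast
      show ?thesis
        unfolding \<sigma>[OF toeplitz_comp[OF AB]]
        by (rule eqI) (simp add: \<sigma> AB has_symbol_unique[OF F(2)[OF toeplitz_comp[OF AB]] has_symbol_comp[OF F(2)[OF AB(1)] F(2)[OF AB(2)] A']])
    qed
    show "\<sigma> B = (\<lambda>z\<in>circle. cnj (\<sigma> A z))" if "A \<in> toeplitz" "is_adjoint A B" for A B
      unfolding \<sigma>[OF toeplitz_adj[OF that]]
      by (rule eqI) (simp add: \<sigma> that has_symbol_adjoint[OF F(2)[OF that(1)] F(2)[OF toeplitz_adj[OF that]] that(2)])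
    show "\<sigma> shift = U_power 1"
      unfolding \<sigma>[OF shift_in_toeplitz] U_power_def
      by (rule eqI) (simp add: has_symbol_unique[OF F(2)[OF shift_in_toeplitz] has_symbol_shift])
  qed
  then show ?thesis by blast
qed

definition symbol :: "operator \<Rightarrow> complex \<Rightarrow> complex" where
  "symbol = (THE \<sigma>. symbol_map \<sigma>)"

lemma symbol_map_symbol: "symbol_map symbol"
  unfolding symbol_def using symbol_map_exists symbol_map_unique by (metis theI)

section \<open>Left modules\<close>

text \<open>The locale \<open>module\<close> of \<open>HOL-Algebra\<close> requires a commutative ring of scalars. Its record
  type is reused here; the fields \<open>mult\<close> and \<open>one\<close>, which have no meaning for a module, are
  left \<^const>\<open>undefined\<close>.\<close>

locale left_module = R?: ring R + M?: abelian_group M for R (structure) and M (structure) +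
  assumes smult_closed [simp, intro]:
      "\<lbrakk>a \<in> carrier R; x \<in> carrier M\<rbrakk> \<Longrightarrow> a \<odot>\<^bsub>M\<^esub> x \<in> carrier M"
    and smult_l_distr:
      "\<lbrakk>a \<in> carrier R; b \<in> carrier R; x \<in> carrier M\<rbrakk> \<Longrightarrow>
      (a \<oplus>\<^bsub>R\<^esub> b) \<odot>\<^bsub>M\<^esub> x = a \<odot>\<^bsub>M\<^esub> x \<oplus>\<^bsub>M\<^esub> b \<odot>\<^bsub>M\<^esub> x"
    and smult_r_distr:
      "\<lbrakk>a \<in> carrier R; x \<in> carrier M; y \<in> carrier M\<rbrakk> \<Longrightarrow>
      a \<odot>\<^bsub>M\<^esub> (x \<oplus>\<^bsub>M\<^esub> y) = a \<odot>\<^bsub>M\<^esub> x \<oplus>\<^bsub>M\<^esub> a \<odot>\<^bsub>M\<^esub> y"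
    and smult_assoc:
      "\<lbrakk>a \<in> carrier R; b \<in> carrier R; x \<in> carrier M\<rbrakk> \<Longrightarrow>
      (a \<otimes>\<^bsub>R\<^esub> b) \<odot>\<^bsub>M\<^esub> x = a \<odot>\<^bsub>M\<^esub> (b \<odot>\<^bsub>M\<^esub> x)"
    and smult_one [simp]:
      "x \<in> carrier M \<Longrightarrow> \<one>\<^bsub>R\<^esub> \<odot>\<^bsub>M\<^esub> x = x"

definition left_module_iso ::
  "('a, 'r) ring_scheme \<Rightarrow> ('a, 'b, 'm) module_scheme \<Rightarrow> ('a, 'c, 'n) module_scheme \<Rightarrow> ('b \<Rightarrow> 'c) set" where
  "left_module_iso R M N = {f. bij_betw f (carrier M) (carrier N) \<and>
     (\<forall>x\<in>carrier M. \<forall>y\<in>carrier M. f (x \<oplus>\<^bsub>M\<^esub> y) = f x \<oplus>\<^bsub>N\<^esub> f y) \<and>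
     (\<forall>a\<in>carrier R. \<forall>x\<in>carrier M. f (a \<odot>\<^bsub>M\<^esub> x) = a \<odot>\<^bsub>N\<^esub> f x)}"

definition left_module_isomorphic ::
  "('a, 'r) ring_scheme \<Rightarrow> ('a, 'b, 'm) module_scheme \<Rightarrow> ('a, 'c, 'n) module_scheme \<Rightarrow> bool" where
  "left_module_isomorphic R M N \<longleftrightarrow>
     left_module R M \<and> left_module R N \<and> left_module_iso R M N \<noteq> {}"

definition module_direct_sum ::
  "('a, 'b, 'm) module_scheme \<Rightarrow> ('a, 'c, 'n) module_scheme \<Rightarrow> ('a, 'b \<times> 'c) module" where
  "module_direct_sum M N =
     \<lparr>carrier = carrier M \<times> carrier N, mult = undefined, one = undefined,
      zero = (\<zero>\<^bsub>M\<^esub>, \<zero>\<^bsub>N\<^esub>),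
      add = (\<lambda>(x, y) (x', y'). (x \<oplus>\<^bsub>M\<^esub> x', y \<oplus>\<^bsub>N\<^esub> y')),
      smult = (\<lambda>a (x, y). (a \<odot>\<^bsub>M\<^esub> x, a \<odot>\<^bsub>N\<^esub> y))\<rparr>"

definition free_module :: "('a, 'r) ring_scheme \<Rightarrow> nat \<Rightarrow> ('a, nat \<Rightarrow> 'a) module" where
  "free_module R n =
     \<lparr>carrier = {..<n} \<rightarrow>\<^sub>E carrier R, mult = undefined, one = undefined,
      zero = (\<lambda>i\<in>{..<n}. \<zero>\<^bsub>R\<^esub>),
      add = (\<lambda>x y. \<lambda>i\<in>{..<n}. x i \<oplus>\<^bsub>R\<^esub> y i),
      smult = (\<lambda>a x. \<lambda>i\<in>{..<n}. a \<otimes>\<^bsub>R\<^esub> x i)\<rparr>"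

section \<open>The generic Podles sphere and its quantum line bundles\<close>

text \<open>The algebra of the generic Podles sphere with parameters \<open>q\<close> in \<open>(0,1)\<close> and \<open>s > 0\<close> is
  taken to be the fibre product of two copies of the Toeplitz algebra over the symbol map;
  this C*-algebra, and with it everything below, does not depend on \<open>q\<close> and \<open>s\<close>.\<close>

definition podles_sphere :: "(operator \<times> operator) ring" where
  "podles_sphere =
     \<lparr>carrier = {(a\<^sub>0, a\<^sub>1). a\<^sub>0 \<in> toeplitz \<and> a\<^sub>1 \<in> toeplitz \<and> symbol a\<^sub>0 = symbol a\<^sub>1},
      mult = (\<lambda>(b\<^sub>0, b\<^sub>1) (a\<^sub>0, a\<^sub>1). (b\<^sub>0 o\<^sub>L a\<^sub>0, b\<^sub>1 o\<^sub>L a\<^sub>1)),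
      one = (id_blinfun, id_blinfun),
      zero = (0, 0),
      add = (\<lambda>(b\<^sub>0, b\<^sub>1) (a\<^sub>0, a\<^sub>1). (b\<^sub>0 + a\<^sub>0, b\<^sub>1 + a\<^sub>1))\<rparr>"

definition line_bundle :: "int \<Rightarrow> (operator \<times> operator, operator \<times> operator) module" where
  "line_bundle N =
     \<lparr>carrier = {(a\<^sub>0, a\<^sub>1). a\<^sub>0 \<in> toeplitz \<and> a\<^sub>1 \<in> toeplitz \<and>
                   (\<lambda>z\<in>circle. U_power N z * symbol a\<^sub>0 z) = symbol a\<^sub>1},
      mult = undefined, one = undefined,
      zero = (0, 0),
      add = (\<lambda>(b\<^sub>0, b\<^sub>1) (a\<^sub>0, a\<^sub>1). (b\<^sub>0 + a\<^sub>0, b\<^sub>1 + a\<^sub>1)),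
      smult = (\<lambda>(b\<^sub>0, b\<^sub>1) (a\<^sub>0, a\<^sub>1). (b\<^sub>0 o\<^sub>L a\<^sub>0, b\<^sub>1 o\<^sub>L a\<^sub>1))\<rparr>"

end

theory Submission
  imports Defs
begin

text \<open>Let \<open>S\<close> in the Toeplitz algebra have symbol \<open>z\<^sup>n\<close> and a left inverse \<open>B\<close> (a power of the
  shift and its adjoint), and put \<open>P = 1 - S B\<close>. The matrix with rows \<open>(S, P)\<close> and \<open>(0, B)\<close> is
  invertible, with inverse of rows \<open>(B, 0)\<close> and \<open>(P, S)\<close>. It lifts \<open>diag(z\<^sup>n, z\<^sup>-\<^sup>n)\<close>, the
  clutching function of \<open>L\<^sub>n \<oplus> L\<^sub>-\<^sub>n\<close>, to the Toeplitz algebra. Hence right multiplication by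
  this matrix on the zeroth components, together with the identity on the first components,
  maps \<open>L\<^sub>n \<oplus> L\<^sub>-\<^sub>n\<close> isomorphically onto the free module. For negative winding numbers the
  inverse matrix plays the same role.\<close>

section \<open>Arithmetic of Toeplitz operators and their symbols\<close>

lemmas blinfun_compose_add_left = bounded_bilinear.add_left[OF bounded_bilinear_blinfun_compose]
  and blinfun_compose_add_right = bounded_bilinear.add_right[OF bounded_bilinear_blinfun_compose]

lemma blinfun_compose_assoc: "(A o\<^sub>L B) o\<^sub>L C = A o\<^sub>L (B o\<^sub>L C)"
  by (rule blinfun_eqI) simp

lemma blinfun_compose_id [simp]: "A o\<^sub>L id_blinfun = A" "id_blinfun o\<^sub>L A = A"
  by (rule blinfun_eqI, simp)+

lemma toeplitz_diff: "A \<in> toeplitz \<Longrightarrow> B \<in> toeplitz \<Longrightarrow> A - B \<in> toeplitz"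
  using toeplitz_add[OF _ uminus_in_toeplitz, of A B] by simp

lemmas toeplitz_intros =
  toeplitz_add toeplitz_comp toeplitz_diff uminus_in_toeplitz zero_in_toeplitz id_in_toeplitz

lemmas symbol_add = symbol_map_add[OF symbol_map_symbol]
  and symbol_comp = symbol_map_comp[OF symbol_map_symbol]
  and symbol_diff = symbol_map_diff[OF symbol_map_symbol]
  and symbol_shift = symbol_map_shift[OF symbol_map_symbol]

lemma symbol_zero: "z \<in> circle \<Longrightarrow> symbol 0 z = 0"
  using symbol_diff[OF zero_in_toeplitz zero_in_toeplitz] by simp

lemma symbol_uminus: "A \<in> toeplitz \<Longrightarrow> z \<in> circle \<Longrightarrow> symbol (- A) z = - symbol A z"
  using symbol_diff[OF zero_in_toeplitz, of A z] by (simp add: symbol_zero)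

text \<open>Unitality is not among the clauses of \<open>symbol_map\<close>; it follows by
  cancelling the symbol of the shift, which vanishes nowhere on the circle.\<close>

lemma symbol_id:
  assumes "z \<in> circle" shows "symbol id_blinfun z = 1"
proof -
  have "symbol shift z = symbol shift z * symbol id_blinfun z"
    using symbol_comp[OF shift_in_toeplitz id_in_toeplitz assms] by simp
  then show ?thesis
    using assms by (auto simp: symbol_shift circle_def)
qed

lemmas symbol_simps = symbol_add symbol_comp symbol_diff symbol_zero symbol_uminus symbol_id

lemma symbol_extensional: "A \<in> toeplitz \<Longrightarrow> symbol A \<in> extensional circle"
  using symbol_map_symbol by (auto simp: symbol_map_def C_circle_def)

section \<open>The modules involved\<close>

lemma podles_sphere_carrier_iff:
  "(a\<^sub>0, a\<^sub>1) \<in> carrier podles_sphere \<longleftrightarrow>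
     a\<^sub>0 \<in> toeplitz \<and> a\<^sub>1 \<in> toeplitz \<and> (\<forall>z\<in>circle. symbol a\<^sub>0 z = symbol a\<^sub>1 z)"
  unfolding podles_sphere_def by (auto intro: extensionalityI[OF symbol_extensional symbol_extensional])

text \<open>Both sides of the gluing condition are extensional on the circle, so it can be checked
  pointwise, where the algebraic rules for symbols apply.\<close>

lemma line_bundle_carrier_iff:
  "(a\<^sub>0, a\<^sub>1) \<in> carrier (line_bundle N) \<longleftrightarrow>
     a\<^sub>0 \<in> toeplitz \<and> a\<^sub>1 \<in> toeplitz \<and> (\<forall>z\<in>circle. z powi N * symbol a\<^sub>0 z = symbol a\<^sub>1 z)"
proof -
  have "(\<lambda>z\<in>circle. U_power N z * symbol a\<^sub>0 z) = symbol a\<^sub>1"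
    if "a\<^sub>1 \<in> toeplitz" "\<forall>z\<in>circle. z powi N * symbol a\<^sub>0 z = symbol a\<^sub>1 z"
    using that
    by (intro extensionalityI[OF restrict_extensional symbol_extensional]) (auto simp: U_power_def)
  moreover have "z powi N * symbol a\<^sub>0 z = symbol a\<^sub>1 z"
    if "(\<lambda>z\<in>circle. U_power N z * symbol a\<^sub>0 z) = symbol a\<^sub>1" "z \<in> circle" for z
    using fun_cong[OF that(1), of z] that(2) by (simp add: U_power_def)
  ultimately show ?thesis unfolding line_bundle_def by auto
qed

lemma podles_sphere_ops [simp]:
  "(b\<^sub>0, b\<^sub>1) \<otimes>\<^bsub>podles_sphere\<^esub> (a\<^sub>0, a\<^sub>1) = (b\<^sub>0 o\<^sub>L a\<^sub>0, b\<^sub>1 o\<^sub>L a\<^sub>1)"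
  "(b\<^sub>0, b\<^sub>1) \<oplus>\<^bsub>podles_sphere\<^esub> (a\<^sub>0, a\<^sub>1) = (b\<^sub>0 + a\<^sub>0, b\<^sub>1 + a\<^sub>1)"
  "\<one>\<^bsub>podles_sphere\<^esub> = (id_blinfun, id_blinfun)"
  "\<zero>\<^bsub>podles_sphere\<^esub> = (0, 0)"
  by (simp_all add: podles_sphere_def)

lemma line_bundle_ops [simp]:
  "(b\<^sub>0, b\<^sub>1) \<odot>\<^bsub>line_bundle N\<^esub> (a\<^sub>0, a\<^sub>1) = (b\<^sub>0 o\<^sub>L a\<^sub>0, b\<^sub>1 o\<^sub>L a\<^sub>1)"
  "(b\<^sub>0, b\<^sub>1) \<oplus>\<^bsub>line_bundle N\<^esub> (a\<^sub>0, a\<^sub>1) = (b\<^sub>0 + a\<^sub>0, b\<^sub>1 + a\<^sub>1)"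
  "\<zero>\<^bsub>line_bundle N\<^esub> = (0, 0)"
  by (simp_all add: line_bundle_def)

lemma ring_podles_sphere: "ring podles_sphere"
proof (rule ringI)
  show "abelian_group podles_sphere"
  proof (rule abelian_groupI)
    fix x assume "x \<in> carrier podles_sphere"
    then show "\<exists>y\<in>carrier podles_sphere. y \<oplus>\<^bsub>podles_sphere\<^esub> x = \<zero>\<^bsub>podles_sphere\<^esub>"
      by (cases x, intro bexI[of _ "(- fst x, - snd x)"])
         (auto simp: podles_sphere_carrier_iff symbol_simps intro: toeplitz_intros)
  qed (auto simp: podles_sphere_carrier_iff symbol_simps intro: toeplitz_intros)
  show "Group.monoid podles_sphere"
    by (rule Group.monoidI)
       (auto simp: podles_sphere_carrier_iff symbol_simps blinfun_compose_assoc intro: toeplitz_intros)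
qed (auto simp: podles_sphere_carrier_iff blinfun_compose_add_left blinfun_compose_add_right)

lemma left_module_line_bundle: "left_module podles_sphere (line_bundle N)"
proof (intro left_module.intro left_module_axioms.intro ring_podles_sphere)
  show "abelian_group (line_bundle N)"
  proof (rule abelian_groupI)
    fix x assume "x \<in> carrier (line_bundle N)"
    then show "\<exists>y\<in>carrier (line_bundle N). y \<oplus>\<^bsub>line_bundle N\<^esub> x = \<zero>\<^bsub>line_bundle N\<^esub>"
      by (cases x, intro bexI[of _ "(- fst x, - snd x)"])
         (auto simp: line_bundle_carrier_iff symbol_simps intro: toeplitz_intros)
  qed (auto simp: line_bundle_carrier_iff symbol_simps distrib_left intro: toeplitz_intros)
\<comment> \<open>For closure under the action, \<open>mult.left_commute\<close> carries
  \<open>z powi N\<close> past the symbol of the scalar, which is the same for both of its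
  components.\<close>
qed (auto simp: line_bundle_carrier_iff podles_sphere_carrier_iff symbol_simps blinfun_compose_assoc
    blinfun_compose_add_left blinfun_compose_add_right mult.left_commute intro: toeplitz_intros)

lemma left_module_direct_sum:
  assumes "left_module R M" "left_module R N"
  shows "left_module R (module_direct_sum M N)"
proof -
  interpret M: left_module R M by fact
  interpret N: left_module R N by fact
  show ?thesis
  proof (intro left_module.intro left_module_axioms.intro M.R.ring_axioms)
    show "abelian_group (module_direct_sum M N)"
    proof (rule abelian_groupI)
      fix x assume "x \<in> carrier (module_direct_sum M N)"
      then show "\<exists>y\<in>carrier (module_direct_sum M N).
          y \<oplus>\<^bsub>module_direct_sum M N\<^esub> x = \<zero>\<^bsub>module_direct_sum M N\<^esub>"
        by (intro bexI[of _ "(\<ominus>\<^bsub>M\<^esub> fst x, \<ominus>\<^bsub>N\<^esub> snd x)"])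
           (auto simp: module_direct_sum_def M.M.l_neg N.M.l_neg)
    qed (auto simp: module_direct_sum_def M.M.a_ac N.M.a_ac)
  qed (auto simp: module_direct_sum_def M.smult_l_distr N.smult_l_distr M.smult_r_distr
      N.smult_r_distr M.smult_assoc N.smult_assoc)
qed

lemma left_module_free_module:
  assumes "ring R"
  shows "left_module R (free_module R n)"
proof -
  interpret ring R by fact
  let ?F = "free_module R n"
  have mem: "x i \<in> carrier R" if "x \<in> carrier ?F" "i < n" for x i
    using that by (auto simp: free_module_def)
  \<comment> \<open>Outside \<open>{..<n}\<close> all elements are \<open>undefined\<close>.
    Together with \<open>app\<close> this reduces each module law to a ring law in every
    coordinate.\<close>
  have ext: "x = y" if "x \<in> carrier ?F" "y \<in> carrier ?F" "\<And>i. i < n \<Longrightarrow> x i = y i" for x y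
    using that unfolding free_module_def by (auto intro: PiE_ext)
  have app: "(x \<oplus>\<^bsub>?F\<^esub> y) i = x i \<oplus>\<^bsub>R\<^esub> y i" "(a \<odot>\<^bsub>?F\<^esub> x) i = a \<otimes>\<^bsub>R\<^esub> x i" "\<zero>\<^bsub>?F\<^esub> i = \<zero>\<^bsub>R\<^esub>"
    if "i < n" for a x y i
    using that by (simp_all add: free_module_def)
  have closed: "x \<oplus>\<^bsub>?F\<^esub> y \<in> carrier ?F" if "x \<in> carrier ?F" "y \<in> carrier ?F" for x y
    using mem[OF that(1)] mem[OF that(2)] by (simp add: free_module_def)
  have smult_closed: "a \<odot>\<^bsub>?F\<^esub> x \<in> carrier ?F" if "a \<in> carrier R" "x \<in> carrier ?F" for a x
    using mem[OF that(2)] that(1) by (simp add: free_module_def)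
  have zero_closed: "\<zero>\<^bsub>?F\<^esub> \<in> carrier ?F"
    by (simp add: free_module_def)
  note closures = closed smult_closed zero_closed
  show ?thesis
  proof (intro left_module.intro left_module_axioms.intro ring_axioms)
    show "abelian_group ?F"
    proof (rule abelian_groupI)
      fix x assume x: "x \<in> carrier ?F"
      let ?y = "\<lambda>i\<in>{..<n}. \<ominus>\<^bsub>R\<^esub> x i"
      have y: "?y \<in> carrier ?F"
        using mem[OF x] by (simp add: free_module_def)
      have "?y \<oplus>\<^bsub>?F\<^esub> x = \<zero>\<^bsub>?F\<^esub>"
        using mem[OF x] by (intro ext closures x y) (simp add: app l_neg)
      with y show "\<exists>y\<in>carrier ?F. y \<oplus>\<^bsub>?F\<^esub> x = \<zero>\<^bsub>?F\<^esub>" by blast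
    qed (auto intro!: ext closures simp: app mem a_ac)
  qed (auto intro!: ext closures simp: app mem l_distr r_distr m_assoc)
qed

section \<open>Invertible lifts of the clutching function and the isomorphism\<close>

text \<open>Each induction step puts \<open>shift\<close> to the left of \<open>S\<close> and
  \<open>backshift\<close> to the right of \<open>B\<close>, so that the inner pair cancels first.
  The symbol of \<open>B\<close> is left out because \<open>B o\<^sub>L S = id_blinfun\<close>
  determines it.\<close>

lemma toeplitz_left_invertible_exists:
  "\<exists>S\<in>toeplitz. \<exists>B\<in>toeplitz. B o\<^sub>L S = id_blinfun \<and> (\<forall>z\<in>circle. symbol S z = z ^ n)"
proof (induction n)
  case 0
  then show ?case
    by (intro bexI[of _ id_blinfun]) (auto simp: id_in_toeplitz symbol_id)
next
  case (Suc n)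
  then obtain S B where *: "S \<in> toeplitz" "B \<in> toeplitz" "B o\<^sub>L S = id_blinfun"
    "\<And>z. z \<in> circle \<Longrightarrow> symbol S z = z ^ n" by blast
  have "(B o\<^sub>L backshift) o\<^sub>L (shift o\<^sub>L S) = B o\<^sub>L ((backshift o\<^sub>L shift) o\<^sub>L S)"
    by (simp only: blinfun_compose_assoc)
  then have "(B o\<^sub>L backshift) o\<^sub>L (shift o\<^sub>L S) = id_blinfun"
    by (simp only: backshift_shift blinfun_compose_id *)
  then show ?case
    by (intro bexI[of _ "shift o\<^sub>L S"] bexI[of _ "B o\<^sub>L backshift"])
       (auto simp: * symbol_comp symbol_shift shift_in_toeplitz backshift_in_toeplitz toeplitz_comp)
qed

text \<open>This is associativity for the row \<open>(a, b)\<close>, the matrix with rows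
  \<open>(v, w)\<close>, \<open>(v', w')\<close> and the column \<open>(p, p')\<close>, whose
  product with the matrix is the column \<open>(x, x')\<close>.\<close>

lemma matrix_inverse_right_mult:
  assumes "(v o\<^sub>L p) + (w o\<^sub>L p') = x" "(v' o\<^sub>L p) + (w' o\<^sub>L p') = x'"
  shows "(((a o\<^sub>L v) + (b o\<^sub>L v')) o\<^sub>L p) + (((a o\<^sub>L w) + (b o\<^sub>L w')) o\<^sub>L p')
    = (a o\<^sub>L x) + (b o\<^sub>L x')"
  unfolding assms[symmetric]
  by (simp add: blinfun_compose_add_left blinfun_compose_add_right blinfun_compose_assoc add_ac)

text \<open>The matrix with rows \<open>(v, w)\<close>, \<open>(v', w')\<close> lifts
  \<open>diag(z^N, z^-N)\<close>, and the one with rows \<open>(p, r)\<close>,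
  \<open>(p', r')\<close> is its two-sided inverse. Keeping the entries abstract covers both signs
  of \<open>N\<close> at once.\<close>

lemma line_bundle_sum_free:
  assumes T: "v \<in> toeplitz" "w \<in> toeplitz" "v' \<in> toeplitz" "w' \<in> toeplitz"
      "p \<in> toeplitz" "r \<in> toeplitz" "p' \<in> toeplitz" "r' \<in> toeplitz"
    and symb: "\<And>z. z \<in> circle \<Longrightarrow> symbol v z = z powi N" "\<And>z. z \<in> circle \<Longrightarrow> symbol w z = 0"
      "\<And>z. z \<in> circle \<Longrightarrow> symbol v' z = 0" "\<And>z. z \<in> circle \<Longrightarrow> symbol w' z = z powi (- N)"
      "\<And>z. z \<in> circle \<Longrightarrow> symbol p z = z powi (- N)" "\<And>z. z \<in> circle \<Longrightarrow> symbol r z = 0"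
      "\<And>z. z \<in> circle \<Longrightarrow> symbol p' z = 0" "\<And>z. z \<in> circle \<Longrightarrow> symbol r' z = z powi N"
    and inv: "(v o\<^sub>L p) + (w o\<^sub>L p') = id_blinfun" "(v o\<^sub>L r) + (w o\<^sub>L r') = 0"
      "(v' o\<^sub>L p) + (w' o\<^sub>L p') = 0" "(v' o\<^sub>L r) + (w' o\<^sub>L r') = id_blinfun"
      "(p o\<^sub>L v) + (r o\<^sub>L v') = id_blinfun" "(p o\<^sub>L w) + (r o\<^sub>L w') = 0"
      "(p' o\<^sub>L v) + (r' o\<^sub>L v') = 0" "(p' o\<^sub>L w) + (r' o\<^sub>L w') = id_blinfun"
  shows "left_module_isomorphic podles_sphere
           (module_direct_sum (line_bundle N) (line_bundle (- N)))
           (free_module podles_sphere 2)"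
proof -
  let ?M = "module_direct_sum (line_bundle N) (line_bundle (- N))"
  let ?F = "free_module podles_sphere 2"
  \<comment> \<open>The row \<open>(a\<^sub>0, b\<^sub>0)\<close> is multiplied by the matrix. Its
    symbols become \<open>z^N\<close> and \<open>z^-N\<close> times the old ones, hence those of
    \<open>a\<^sub>1\<close> and \<open>b\<^sub>1\<close>, so both pairs land in the sphere
    algebra.\<close>
  let ?f = "\<lambda>((a\<^sub>0, a\<^sub>1), (b\<^sub>0, b\<^sub>1)). \<lambda>i\<in>{..<2::nat}.
     if i = 0 then ((a\<^sub>0 o\<^sub>L v) + (b\<^sub>0 o\<^sub>L v'), a\<^sub>1) else ((a\<^sub>0 o\<^sub>L w) + (b\<^sub>0 o\<^sub>L w'), b\<^sub>1)"
  let ?g = "\<lambda>x. (((fst (x 0) o\<^sub>L p) + (fst (x (1::nat)) o\<^sub>L p'), snd (x 0)),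
                 ((fst (x 0) o\<^sub>L r) + (fst (x 1) o\<^sub>L r'), snd (x 1)))"
  \<comment> \<open>In \<open>g_carrier\<close>, the gluing factor of each line bundle cancels the
    twist that the inverse matrix puts on the symbol.\<close>
  have pow: "z powi N * (c * z powi (- N)) = c" "z powi (- N) * (c * z powi N) = c"
    if "z \<in> circle" for z c
  proof -
    have "z powi N \<noteq> 0" using that by (auto simp: circle_def)
    then show "z powi N * (c * z powi (- N)) = c" "z powi (- N) * (c * z powi N) = c"
      by (simp_all add: power_int_minus)
  qed
  have f_carrier: "?f x \<in> carrier ?F" if "x \<in> carrier ?M" for x
    using that T
    by (auto simp: module_direct_sum_def free_module_def line_bundle_carrier_iff
        podles_sphere_carrier_iff symbol_simps toeplitz_intros symb mult.commute split: if_splits)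
  have g_carrier: "?g x \<in> carrier ?M" if "x \<in> carrier ?F" for x
  proof -
    obtain a\<^sub>0 a\<^sub>1 b\<^sub>0 b\<^sub>1 where x: "x 0 = (a\<^sub>0, a\<^sub>1)" "x 1 = (b\<^sub>0, b\<^sub>1)"
      by (meson surj_pair)
    have "x i \<in> carrier podles_sphere" if "i < 2" for i
      using that \<open>x \<in> carrier ?F\<close> by (auto simp: free_module_def)
    from this[of 0] this[of 1]
    have "(a\<^sub>0, a\<^sub>1) \<in> carrier podles_sphere" "(b\<^sub>0, b\<^sub>1) \<in> carrier podles_sphere"
      by (simp_all add: x del: One_nat_def)
    then show ?thesis
      using T unfolding x
      by (auto simp: module_direct_sum_def line_bundle_carrier_iff podles_sphere_carrier_iff
          symbol_simps toeplitz_intros symb pow)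
  qed
  have "bij_betw ?f (carrier ?M) (carrier ?F)"
  proof (rule bij_betw_byWitness[of _ ?g])
    show "\<forall>x\<in>carrier ?M. ?g (?f x) = x"
      \<comment> \<open>The pairs \<open>inv(1,3)\<close> and \<open>inv(2,4)\<close> are the two
        columns of the matrix times its inverse; \<open>inv(5,7)\<close> and \<open>inv(6,8)\<close>
        below are those of the opposite product.\<close>
      by (auto simp: matrix_inverse_right_mult[OF inv(1,3)] matrix_inverse_right_mult[OF inv(2,4)])
    show "\<forall>x\<in>carrier ?F. ?f (?g x) = x"
    proof
      fix x assume "x \<in> carrier ?F"
      \<comment> \<open>Equality of functions on all of \<open>nat\<close> also needs the default
        value off the two indices.\<close>
      then have "x i = undefined" if "\<not> i < 2" for i
        using that PiE_arb[of x "{..<2}" "\<lambda>_. carrier podles_sphere" i]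
        by (simp add: free_module_def)
      then show "?f (?g x) = x"
        by (auto simp: matrix_inverse_right_mult[OF inv(5,7)] matrix_inverse_right_mult[OF inv(6,8)]
            restrict_def less_2_cases_iff intro!: ext)
    qed
  qed (use f_carrier g_carrier in blast)+
  moreover have "?f (x \<oplus>\<^bsub>?M\<^esub> y) = ?f x \<oplus>\<^bsub>?F\<^esub> ?f y" for x y
    by (cases x; cases y)
       (auto simp: module_direct_sum_def free_module_def blinfun_compose_add_left add_ac
         split: prod.splits intro!: restrict_ext)
  \<comment> \<open>Multiplication from the right commutes with the left action by
    associativity.\<close>
  moreover have "?f (a \<odot>\<^bsub>?M\<^esub> x) = a \<odot>\<^bsub>?F\<^esub> ?f x" for a x
    by (cases a; cases x)
       (auto simp: module_direct_sum_def free_module_def blinfun_compose_add_right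
         blinfun_compose_assoc split: prod.splits intro!: restrict_ext)
  ultimately have "?f \<in> left_module_iso podles_sphere ?M ?F"
    unfolding left_module_iso_def by blast
  then show ?thesis
    unfolding left_module_isomorphic_def
    using left_module_direct_sum[OF left_module_line_bundle left_module_line_bundle]
      left_module_free_module[OF ring_podles_sphere] by blast
qed

theorem corollary4p4:
  fixes N :: int
  shows "left_module_isomorphic podles_sphere
           (module_direct_sum (line_bundle N) (line_bundle (- N)))
           (free_module podles_sphere 2)"
proof -
  obtain n where n: "N = int n \<or> N = - int n"
    by (cases N rule: int_cases2) blast+
  obtain S B where S: "S \<in> toeplitz" and B: "B \<in> toeplitz" and BS: "B o\<^sub>L S = id_blinfun"
    and sS: "\<And>z. z \<in> circle \<Longrightarrow> symbol S z = z powi int n"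
    using toeplitz_left_invertible_exists[of n] by auto
  \<comment> \<open>Symbols are scalar-valued, so a left inverse has the reciprocal symbol.\<close>
  have sB: "symbol B z = z powi (- int n)" if z: "z \<in> circle" for z
  proof -
    have "symbol B z * z powi int n = 1"
      using symbol_comp[OF B S z] by (simp add: BS symbol_id z sS del: power_int_of_nat)
    then show ?thesis
      by (simp only: power_int_minus inverse_unique mult.commute)
  qed
  \<comment> \<open>Since \<open>B o\<^sub>L S = id_blinfun\<close>, the product
    \<open>S o\<^sub>L B\<close> is idempotent and \<open>P\<close> is the complementary
    idempotent.\<close>
  define P where "P = id_blinfun - (S o\<^sub>L B)"
  have P: "P \<in> toeplitz"
    unfolding P_def by (intro toeplitz_intros S B)
  have sP: "symbol P z = 0" if z: "z \<in> circle" for z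
  proof -
    have "z \<noteq> 0" using z by (auto simp: circle_def)
    then show ?thesis
      unfolding P_def by (simp add: symbol_simps toeplitz_intros S B sS sB z power_int_minus)
  qed
  have BS': "B (S x) = x" for x
    using arg_cong[OF BS, of "\<lambda>A. A x"] by simp
  \<comment> \<open>Together with \<open>BS\<close>, these are the nontrivial entries of both matrix
    products.\<close>
  have inv: "P o\<^sub>L S = 0" "B o\<^sub>L P = 0" "(S o\<^sub>L B) + (P o\<^sub>L P) = id_blinfun" "(P o\<^sub>L P) + (S o\<^sub>L B) = id_blinfun"
    by (rule blinfun_eqI, simp add: P_def blinfun.diff_left blinfun.diff_right blinfun.add_left BS')+
  from n show ?thesis
  proof
    assume "N = int n"
    then show ?thesis
      using S B P sS sB sP BS inv zero_in_toeplitz symbol_zero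
      by (intro line_bundle_sum_free[of S P 0 B B 0 P S]) auto
  next
    assume "N = - int n"
    then show ?thesis
      using S B P sS sB sP BS inv zero_in_toeplitz symbol_zero
      \<comment> \<open>The matrix and its inverse trade places, as \<open>B\<close> now carries the
        symbol \<open>z powi N\<close>.\<close>
      by (intro line_bundle_sum_free[of B 0 P S S P 0 B]) auto
  qed
qed

end
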